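(* Let $Q=Q(d,d_0)$ be any compact connected two-point homogeneous space (normalized as in the context), let $\eta^{\natural}(r)=\sin r$, $r\in[0,\pi]$, and let $\gamma(Q)=\langle\tau\rangle/\langle\theta^{\Delta}(\eta^{\natural})\rangle$. Then for every $N$-point subset $\mathcal D_N\subset Q$, $$\gamma(Q)\,\lambda[\eta^{\natural},\mathcal D_N]+\tau[\mathcal D_N]=\langle\tau\rangle N^2 .$$ In particular, for every $N$, $$\gamma(Q)\,\lambda_N(\eta^{\natural})+\tau_N=\langle\tau\rangle N^2 .$$
   Context: Spaces. $Q=Q(d,d_0)$ is one of the following: the sphere $S^d$, $d\ge 1$, with the convention $d_0=d$; or a projective space $\mathbb{F}P^n$ with $\mathbb F=\mathbb R,\mathbb C,\mathbb H$, $n\ge2$, or the octonionic projective plane $\mathbb{O}P^2$ ($\mathbb F=\mathbb O$, $n=2$), where $d_0=\dim_{\mathbb R}\mathbb F=1,2,4,8$ for $\mathbb F=\mathbb R,\mathbb C,\mathbb H,\mathbb O$ respectively and $d=nd_0$. $Q$ carries the isometry-invariant Riemannian distance $\theta$, rescaled so that $\operatorname{diam}(Q,\theta)=\pi$, and the isometry-invariant Riemannian measure $\mu$ with $\mu(Q)=1$. Concretely, $S^d=\{x\in\mathbb R^{d+1}:\|x\|=1\}$ with $\cos\theta(x_1,x_2)=(x_1,x_2)$; and $\mathbb{F}P^n$ is the set of Hermitian $(n+1)\times(n+1)$ matrices $\Pi$ over $\mathbb F$ with $\Pi^2=\Pi$, $\operatorname{Tr}\Pi=1$, with $\sin\frac12\theta(\Pi_1,\Pi_2)=\frac1{\sqrt2}\|\Pi_1-\Pi_2\|$,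 $0\le\theta\le\pi$, where $\|A\|^2=\sum_{i,j}|a_{ij}|^2$. Chordal metric: $\tau(x_1,x_2)=\sin\frac12\theta(x_1,x_2)$. Balls: $B_r(y)=\{x\in Q:\theta(x,y)<r\}$, $r\in[0,\pi]$; $v_r=\mu(B_r(y))$ (independent of $y$). $N$-point subsets $\mathcal D_N$ consist of $N$ not necessarily different points (sums and cardinalities count multiplicity). Discrepancies: $\Lambda[B_r(y),\mathcal D_N]=\#\{B_r(y)\cap\mathcal D_N\}-Nv_r$, $\lambda_r[\mathcal D_N]=\int_Q\Lambda[B_r(y),\mathcal D_N]^2\,d\mu(y)$, and for a non-negative weight $\eta$ on $[0,\pi]$, $\lambda[\eta,\mathcal D_N]=\int_0^\pi\lambda_r[\mathcal D_N]\,\eta(r)\,dr$; $\lambda_N(\eta)=\inf_{\mathcal D_N}\lambda[\eta,\mathcal D_N]$ over all $N$-point subsets of $Q$. Metrics: for a metric $\rho$ on $Q$, $\rho[\mathcal D_N]=\sum_{x_1,x_2\in\mathcal D_N}\rho(x_1,x_2)$, $\rho_N=\sup_{\mathcal D_N}\rho[\mathcal D_N]$ over all $N$-point subsets, and $\langle\rho\rangle=\iint_{Q\times Q}\rho(y_1,y_2)\,d\mu(y_1)\,d\mu(y_2)$. Symmetric difference metrics: $\theta^{\Delta}_r(y_1,y_2)=\frac12\mu\big(B_r(y_1)\Delta B_r(y_2)\big)$ and $\theta^{\Delta}(\eta,y_1,y_2)=\int_0^\pi\theta^{\Delta}_r(y_1,y_2)\,\eta(r)\,dr$. *)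

theory Defs
  imports "HOL-Probability.Probability"
begin

section \<open>Quaternions and octonions\<close>

text \<open>The Cayley--Dickson doubling of an algebra with product \<open>m\<close> and conjugation \<open>c\<close>, on pairs:
  \<open>(a,b)(u,v) = (a u - v\<^sup>* b, v a + b u\<^sup>*)\<close> and \<open>(a,b)\<^sup>* = (a\<^sup>*, -b)\<close>. Doubling the complex numbers gives
  the quaternions, and doubling again gives the octonions. The library norm on the product types
  is the usual modulus \<open>|x|\<close>.\<close>

definition cd_mult ::
  "('f \<Rightarrow> 'f \<Rightarrow> 'f) \<Rightarrow> ('f \<Rightarrow> 'f) \<Rightarrow> 'f \<times> 'f \<Rightarrow> 'f \<times> 'f \<Rightarrow> 'f::ab_group_add \<times> 'f" where
  "cd_mult m c x y =
     (m (fst x) (fst y) - m (c (snd y)) (snd x), m (snd y) (fst x) + m (snd x) (c (fst y)))"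

definition cd_cnj :: "('f \<Rightarrow> 'f) \<Rightarrow> 'f \<times> 'f \<Rightarrow> 'f::ab_group_add \<times> 'f" where
  "cd_cnj c x = (c (fst x), - snd x)"

type_synonym quat = "complex \<times> complex"
type_synonym oct = "quat \<times> quat"

definition quat_mult :: "quat \<Rightarrow> quat \<Rightarrow> quat" where "quat_mult = cd_mult (*) cnj"
definition quat_cnj :: "quat \<Rightarrow> quat" where "quat_cnj = cd_cnj cnj"
definition quat_one :: quat where "quat_one = (1, 0)"

definition oct_mult :: "oct \<Rightarrow> oct \<Rightarrow> oct" where "oct_mult = cd_mult quat_mult quat_cnj"
definition oct_cnj :: "oct \<Rightarrow> oct" where "oct_cnj = cd_cnj quat_cnj"
definition oct_one :: oct where "oct_one = (quat_one, 0)"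


section \<open>The spaces and their Riemannian distances\<close>

text \<open>The sphere is the library's \<^term>\<open>sphere 0 1\<close>.\<close>

definition sphere_theta :: "'a::real_inner \<Rightarrow> 'a \<Rightarrow> real" where
  "sphere_theta x y = arccos (x \<bullet> y)"

text \<open>Hermitian idempotents of trace one, over the algebra with product \<open>m\<close>, conjugation \<open>c\<close> and
  unit \<open>e\<close>.\<close>

definition proj_space ::
  "('f \<Rightarrow> 'f \<Rightarrow> 'f) \<Rightarrow> ('f \<Rightarrow> 'f) \<Rightarrow> 'f \<Rightarrow> (('f::euclidean_space)^'m^'m) set" where
  "proj_space m c e = {P.
     (\<forall>i j. P $ j $ i = c (P $ i $ j)) \<and>
     (\<forall>i j. (\<Sum>k\<in>UNIV. m (P $ i $ k) (P $ k $ j)) = P $ i $ j) \<and>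
     (\<Sum>i\<in>UNIV. P $ i $ i) = e}"

abbreviation real_proj_space :: "(real^'m^'m) set" where
  "real_proj_space \<equiv> proj_space (*) (\<lambda>x. x) 1"
abbreviation complex_proj_space :: "(complex^'m^'m) set" where
  "complex_proj_space \<equiv> proj_space (*) cnj 1"
abbreviation quat_proj_space :: "(quat^'m^'m) set" where
  "quat_proj_space \<equiv> proj_space quat_mult quat_cnj quat_one"
abbreviation oct_proj_plane :: "(oct^3^3) set" where
  "oct_proj_plane \<equiv> proj_space oct_mult oct_cnj oct_one"

text \<open>The library norm on \<open>'f^'m^'m\<close> is the Frobenius norm, so this is
  \<open>sin (\<theta>/2) = \<parallel>P - R\<parallel> / \<surd>2\<close> with \<open>0 \<le> \<theta> \<le> \<pi>\<close>; on \<^const>\<open>proj_space\<close> the argument of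
  \<^const>\<open>arcsin\<close> never exceeds 1.\<close>

definition proj_theta :: "('f::euclidean_space)^'m^'m \<Rightarrow> 'f^'m^'m \<Rightarrow> real" where
  "proj_theta P R = 2 * arcsin (norm (P - R) / sqrt 2)"


section \<open>The invariant measure\<close>

text \<open>\<open>\<mu>\<close> is a Borel probability measure on \<open>Q\<close> that is preserved by every isometry of \<open>(Q, \<theta>)\<close>. On a
  compact homogeneous space there is exactly one, the normalized Riemannian measure.\<close>

definition invariant_measure ::
  "'a::topological_space set \<Rightarrow> ('a \<Rightarrow> 'a \<Rightarrow> real) \<Rightarrow> 'a measure \<Rightarrow> bool" where
  "invariant_measure Q \<theta> \<mu> \<longleftrightarrow>
     prob_space \<mu> \<and> sets \<mu> = sets (restrict_space borel Q) \<and>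
     (\<forall>g. bij_betw g Q Q \<and> (\<forall>x\<in>Q. \<forall>y\<in>Q. \<theta> (g x) (g y) = \<theta> x y) \<longrightarrow> distr \<mu> \<mu> g = \<mu>)"


section \<open>Discrepancies and sums of distances\<close>

text \<open>Below, the point set of the space is always \<^term>\<open>space \<mu>\<close>.\<close>

definition metric_ball :: "('a \<Rightarrow> 'a \<Rightarrow> real) \<Rightarrow> 'a measure \<Rightarrow> real \<Rightarrow> 'a \<Rightarrow> 'a set" where
  "metric_ball \<theta> \<mu> r y = {x \<in> space \<mu>. \<theta> x y < r}"

text \<open>Point sets are multisets, as the points need not be different.\<close>

definition point_sets :: "'a measure \<Rightarrow> nat \<Rightarrow> 'a multiset set" where
  "point_sets \<mu> N = {D. set_mset D \<subseteq> space \<mu> \<and> size D = N}"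

text \<open>The volume \<open>v\<^sub>r\<close> is taken at the centre \<open>y\<close> of the ball concerned; by homogeneity it does not
  depend on \<open>y\<close>.\<close>

definition ball_discrepancy ::
  "('a \<Rightarrow> 'a \<Rightarrow> real) \<Rightarrow> 'a measure \<Rightarrow> real \<Rightarrow> 'a \<Rightarrow> 'a multiset \<Rightarrow> real" where
  "ball_discrepancy \<theta> \<mu> r y D =
     real (size {#x \<in># D. x \<in> metric_ball \<theta> \<mu> r y#})
     - real (size D) * measure \<mu> (metric_ball \<theta> \<mu> r y)"

definition discrepancy_at ::
  "('a \<Rightarrow> 'a \<Rightarrow> real) \<Rightarrow> 'a measure \<Rightarrow> real \<Rightarrow> 'a multiset \<Rightarrow> real" where
  "discrepancy_at \<theta> \<mu> r D = (LINT y|\<mu>. (ball_discrepancy \<theta> \<mu> r y D)\<^sup>2)"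

definition discrepancy ::
  "('a \<Rightarrow> 'a \<Rightarrow> real) \<Rightarrow> 'a measure \<Rightarrow> (real \<Rightarrow> real) \<Rightarrow> 'a multiset \<Rightarrow> real" where
  "discrepancy \<theta> \<mu> \<eta> D = (LINT r:{0..pi}|lborel. discrepancy_at \<theta> \<mu> r D * \<eta> r)"

definition min_discrepancy ::
  "('a \<Rightarrow> 'a \<Rightarrow> real) \<Rightarrow> 'a measure \<Rightarrow> (real \<Rightarrow> real) \<Rightarrow> nat \<Rightarrow> real" where
  "min_discrepancy \<theta> \<mu> \<eta> N = (INF D\<in>point_sets \<mu> N. discrepancy \<theta> \<mu> \<eta> D)"

definition distance_sum :: "('a \<Rightarrow> 'a \<Rightarrow> real) \<Rightarrow> 'a multiset \<Rightarrow> real" where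
  "distance_sum \<rho> D = (\<Sum>x\<in>#D. \<Sum>y\<in>#D. \<rho> x y)"

definition max_distance_sum :: "'a measure \<Rightarrow> ('a \<Rightarrow> 'a \<Rightarrow> real) \<Rightarrow> nat \<Rightarrow> real" where
  "max_distance_sum \<mu> \<rho> N = (SUP D\<in>point_sets \<mu> N. distance_sum \<rho> D)"

definition mean_distance :: "'a measure \<Rightarrow> ('a \<Rightarrow> 'a \<Rightarrow> real) \<Rightarrow> real" where
  "mean_distance \<mu> \<rho> = (LINT x|\<mu>. (LINT y|\<mu>. \<rho> x y))"


section \<open>Chordal and symmetric difference metrics\<close>

definition chordal :: "('a \<Rightarrow> 'a \<Rightarrow> real) \<Rightarrow> 'a \<Rightarrow> 'a \<Rightarrow> real" where
  "chordal \<theta> x y = sin (\<theta> x y / 2)"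

definition symdiff_metric_at ::
  "('a \<Rightarrow> 'a \<Rightarrow> real) \<Rightarrow> 'a measure \<Rightarrow> real \<Rightarrow> 'a \<Rightarrow> 'a \<Rightarrow> real" where
  "symdiff_metric_at \<theta> \<mu> r x y =
     measure \<mu> (sym_diff (metric_ball \<theta> \<mu> r x) (metric_ball \<theta> \<mu> r y)) / 2"

definition symdiff_metric ::
  "('a \<Rightarrow> 'a \<Rightarrow> real) \<Rightarrow> 'a measure \<Rightarrow> (real \<Rightarrow> real) \<Rightarrow> 'a \<Rightarrow> 'a \<Rightarrow> real" where
  "symdiff_metric \<theta> \<mu> \<eta> x y = (LINT r:{0..pi}|lborel. symdiff_metric_at \<theta> \<mu> r x y * \<eta> r)"

definition gamma_const :: "('a \<Rightarrow> 'a \<Rightarrow> real) \<Rightarrow> 'a measure \<Rightarrow> real" where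
  "gamma_const \<theta> \<mu> =
     mean_distance \<mu> (chordal \<theta>) / mean_distance \<mu> (symdiff_metric \<theta> \<mu> sin)"

end

theory Submission
  imports Defs
begin

text \<open>Every \<open>Q\<close> lies in a unit sphere of a Euclidean space, with
  \<open>cos \<theta>(x, y) = 1 - \<alpha> (1 - x \<bullet> y)\<close> for a constant \<open>\<alpha>\<close>. Since
  \<open>sin r dr = - d (cos r)\<close>, integrating the symmetric difference of two balls over \<open>r\<close> gives
  \<open>\<theta>\<^sup>\<Delta>(\<eta>, x, x') = \<alpha>/2 \<integral> \<bar>(x - x') \<bullet> y\<bar> d\<mu>(y)\<close>. Isometries of \<open>Q\<close> that are linear
  in the ambient space carry every difference \<open>x - x'\<close> to a multiple of one fixed vector, so
  \<open>\<theta>\<^sup>\<Delta>\<close> is a constant multiple of \<open>\<tau>\<close>; the invariance principle for \<open>\<theta>\<^sup>\<Delta>\<close> itself is an expansion of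
  the square in the discrepancy.

  In the projective spaces, conjugations by real orthogonal matrices and phase changes suffice: two
  points are made real simultaneously, \<open>P = p p\<^sup>T\<close> and \<open>R = r r\<^sup>T\<close>, and then
  \<open>P - R = (x y\<^sup>T + y x\<^sup>T) / 2\<close> with \<open>x = p + r\<close> orthogonal to \<open>y = p - r\<close>. Over the octonions
  the phase changes come from the Moufang identities.\<close>


section \<open>Composition algebras\<close>

text \<open>Every isometry used must be linear on the ambient space, because it acts on differences
  of points and not only on points. The obstacle is the octonions: matrix products do not associate
  there, so conjugation by an octonionic unitary matrix need not preserve idempotents, and the usual
  factorization of a rank-one projection is not at hand. What survives is the multiplicative norm;
  polarized, it yields adjoints, cancellation laws and the Moufang identities. The locale therefore
  assumes such a norm and no associativity, with conjugation given as the reflection in the line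
  through the unit, and treats all four algebras together up to the phase changes. The mean of
  \<open>\<bar>A \<bullet> y\<bar>\<close> that relates the symmetric difference metric to \<tau> is
  never evaluated. Its positivity is enough, because \<gamma>(Q), the quotient of the means of the
  two metrics, is then the reciprocal of their pointwise ratio. In the same spirit the constant term
  of the expanded square is recognized as the mean of the symmetric difference metric by averaging
  over one point.\<close>

locale composition_algebra =
  fixes mul :: "'f::euclidean_space \<Rightarrow> 'f \<Rightarrow> 'f" (infixl "\<odot>" 70)
    and cj :: "'f \<Rightarrow> 'f" and e :: 'f
  assumes bilinear_mul: "bilinear (\<odot>)"
    and unit_left [simp]: "e \<odot> x = x"
    and unit_right [simp]: "x \<odot> e = x"
    and norm_mul: "norm (x \<odot> y) = norm x * norm y"
    and norm_unit [simp]: "norm e = 1"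
    and cj_eq: "cj x = (2 * (x \<bullet> e)) *\<^sub>R e - x"
begin

lemmas mul_simps =
  bilinear_ladd[OF bilinear_mul] bilinear_radd[OF bilinear_mul]
  bilinear_lmul[OF bilinear_mul] bilinear_rmul[OF bilinear_mul]
  bilinear_lneg[OF bilinear_mul] bilinear_rneg[OF bilinear_mul]
  bilinear_lzero[OF bilinear_mul] bilinear_rzero[OF bilinear_mul]
  bilinear_lsub[OF bilinear_mul] bilinear_rsub[OF bilinear_mul]

lemma mul_sum_left: "(\<Sum>i\<in>S. f i) \<odot> y = (\<Sum>i\<in>S. f i \<odot> y)"
  using linear_sum[of "\<lambda>x. x \<odot> y" f S] bilinear_mul by (simp add: bilinear_def)

lemma mul_sum_right: "y \<odot> (\<Sum>i\<in>S. f i) = (\<Sum>i\<in>S. y \<odot> f i)"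
  using linear_sum[of "\<lambda>x. y \<odot> x" f S] bilinear_mul by (simp add: bilinear_def)

lemma unit_nonzero [simp]: "e \<noteq> 0"
  using norm_unit by force

lemma inner_unit [simp]: "e \<bullet> e = 1"
  by (simp add: dot_square_norm)

lemma inner_mul_self: "(x \<odot> y) \<bullet> (x \<odot> y) = (x \<bullet> x) * (y \<bullet> y)"
  by (simp add: dot_square_norm norm_mul power_mult_distrib)

lemma inner_mul_left: "(x \<odot> y) \<bullet> (x \<odot> z) = (x \<bullet> x) * (y \<bullet> z)"
  using inner_mul_self[of x "y + z"] inner_mul_self[of x y] inner_mul_self[of x z]
  by (simp add: mul_simps inner_commute algebra_simps)

lemma inner_mul_right: "(y \<odot> x) \<bullet> (z \<odot> x) = (x \<bullet> x) * (y \<bullet> z)"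
  using inner_mul_self[of "y + z" x] inner_mul_self[of y x] inner_mul_self[of z x]
  by (simp add: mul_simps inner_commute algebra_simps)

text \<open>Polarizing the norm identity in both factors gives its fully multilinear form. It takes
  the place of associativity in deriving the adjoints and the Moufang identities.\<close>

lemma inner_mul_exchange: "(a \<odot> b) \<bullet> (c \<odot> d) = 2 * (a \<bullet> c) * (b \<bullet> d) - (a \<odot> d) \<bullet> (c \<odot> b)"
  using inner_mul_left[of "a + c" b d] inner_mul_left[of a b d] inner_mul_left[of c b d]
  by (simp add: mul_simps inner_commute algebra_simps)

lemma linear_cj: "linear cj"
  by (rule linearI) (simp_all add: cj_eq algebra_simps)

lemma cj_simps [simp]: "cj (x + y) = cj x + cj y" "cj (r *\<^sub>R x) = r *\<^sub>R cj x" "cj (x - y) = cj x - cj y"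
    "cj 0 = 0" "cj (- x) = - cj x" "cj (\<Sum>i\<in>S. f i) = (\<Sum>i\<in>S. cj (f i))"
  using linear_cj by (simp_all add: linear_add linear_cmul linear_diff linear_0 linear_neg linear_sum)

lemma cj_unit [simp]: "cj e = e"
  by (simp add: cj_eq scaleR_2)

lemma cj_cj [simp]: "cj (cj x) = x"
  by (simp add: cj_eq algebra_simps)

lemma inner_cj_left: "cj x \<bullet> y = x \<bullet> cj y"
  by (simp add: cj_eq inner_commute algebra_simps)

lemma inner_cj [simp]: "cj x \<bullet> cj y = x \<bullet> y"
  by (simp add: inner_cj_left)

lemma norm_cj [simp]: "norm (cj x) = norm x"
  by (simp add: norm_eq_sqrt_inner)

text \<open>With \<open>e\<close> as third factor the exchange law pairs \<open>y\<close> with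
  \<open>2 (x \<bullet> e) z - x z\<close>, which is \<open>cj x \<odot> z\<close> by the formula
  for \<open>cj\<close>.\<close>

lemma inner_mul_adjoint_left: "(x \<odot> y) \<bullet> z = y \<bullet> (cj x \<odot> z)"
  using inner_mul_exchange[of x y e z]
  by (simp add: cj_eq mul_simps inner_commute algebra_simps)

lemma inner_mul_adjoint_right: "(x \<odot> y) \<bullet> z = x \<bullet> (z \<odot> cj y)"
  using inner_mul_exchange[of x y z e]
  by (simp add: cj_eq mul_simps inner_commute algebra_simps)

lemma cj_mul: "cj (x \<odot> y) = cj y \<odot> cj x"
proof -
  have "cj (x \<odot> y) \<bullet> z = (cj y \<odot> cj x) \<bullet> z" for z
  proof -
    have "(cj y \<odot> cj x) \<bullet> z = (y \<odot> z) \<bullet> cj x"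
      using inner_mul_adjoint_left[of "cj y" "cj x" z] by (simp add: inner_commute)
    also have "\<dots> = y \<bullet> (cj x \<odot> cj z)"
      by (rule inner_mul_adjoint_right)
    also have "\<dots> = cj (x \<odot> y) \<bullet> z"
      by (simp add: inner_cj_left inner_mul_adjoint_left)
    finally show ?thesis by simp
  qed
  then show ?thesis using vector_eq_rdot by blast
qed

text \<open>Moving \<open>cj x\<close> across an inner product with an arbitrary \<open>z\<close>
  turns this into \<open>inner_mul_left\<close>. It is a restricted form of associativity that
  survives in the octonions.\<close>

lemma cj_mul_cancel_left: "cj x \<odot> (x \<odot> y) = (x \<bullet> x) *\<^sub>R y"
proof -
  have "(cj x \<odot> (x \<odot> y)) \<bullet> z = ((x \<bullet> x) *\<^sub>R y) \<bullet> z" for z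
    by (simp add: inner_mul_adjoint_left[of "cj x"] inner_mul_left)
  then show ?thesis using vector_eq_rdot by blast
qed

lemma mul_cj_cancel_left: "x \<odot> (cj x \<odot> y) = (x \<bullet> x) *\<^sub>R y"
  using cj_mul_cancel_left[of "cj x" y] by simp

lemma mul_cj_cancel_right: "(y \<odot> x) \<odot> cj x = (x \<bullet> x) *\<^sub>R y"
proof -
  have "((y \<odot> x) \<odot> cj x) \<bullet> z = ((x \<bullet> x) *\<^sub>R y) \<bullet> z" for z
    by (simp add: inner_mul_adjoint_right[of _ "cj x"] inner_mul_right)
  then show ?thesis using vector_eq_rdot by blast
qed

lemma cj_mul_cancel_right: "(y \<odot> cj x) \<odot> x = (x \<bullet> x) *\<^sub>R y"
  using mul_cj_cancel_right[of y "cj x"] by simp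

lemma mul_cj_self: "x \<odot> cj x = (x \<bullet> x) *\<^sub>R e"
  using mul_cj_cancel_right[of e x] by simp

lemma cj_mul_self: "cj x \<odot> x = (x \<bullet> x) *\<^sub>R e"
  using mul_cj_self[of "cj x"] by simp

text \<open>By the exchange law the inner product of the left-hand side with \<open>t\<close> depends on \<open>y\<close> and \<open>z\<close>
  only through \<open>y \<odot> z\<close>, so that \<open>(y, z)\<close> may be replaced by \<open>(y \<odot> z, e)\<close>.\<close>

lemma moufang_middle: "(x \<odot> y) \<odot> (z \<odot> x) = (x \<odot> (y \<odot> z)) \<odot> x"
proof -
  have *: "((x \<odot> y) \<odot> (z \<odot> x)) \<bullet> t
      = 2 * (x \<bullet> t) * ((y \<odot> z) \<bullet> cj x) - (x \<bullet> x) * ((y \<odot> z) \<bullet> cj t)" for y z t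
  proof -
    have "((x \<odot> y) \<odot> (z \<odot> x)) \<bullet> t = (x \<odot> y) \<bullet> (t \<odot> (cj x \<odot> cj z))"
      by (simp add: inner_mul_adjoint_right[of "x \<odot> y"] cj_mul)
    also have "\<dots> = 2 * (x \<bullet> t) * (y \<bullet> (cj x \<odot> cj z)) - (x \<odot> (cj x \<odot> cj z)) \<bullet> (t \<odot> y)"
      by (rule inner_mul_exchange)
    also have "\<dots> = 2 * (x \<bullet> t) * (y \<bullet> (cj x \<odot> cj z)) - (x \<bullet> x) * ((t \<odot> y) \<bullet> cj z)"
      by (simp add: mul_cj_cancel_left inner_commute)
    also have "y \<bullet> (cj x \<odot> cj z) = (y \<odot> z) \<bullet> cj x"
      by (simp add: inner_mul_adjoint_right)
    also have "(t \<odot> y) \<bullet> cj z = (y \<odot> z) \<bullet> cj t"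
      by (simp add: inner_mul_adjoint_right[of y] inner_mul_adjoint_left[of t])
    finally show ?thesis .
  qed
  have "((x \<odot> y) \<odot> (z \<odot> x)) \<bullet> t = ((x \<odot> (y \<odot> z)) \<odot> x) \<bullet> t" for t
    using *[of y z t] *[of "y \<odot> z" e t] by simp
  then show ?thesis using vector_eq_rdot by blast
qed

text \<open>The middle Moufang identity with one inner factor equal to \<open>e\<close>; it makes
  the product \<open>u x u\<close> unambiguous.\<close>

lemma sandwich_assoc: "(u \<odot> x) \<odot> u = u \<odot> (x \<odot> u)"
  using moufang_middle[of u e x] by simp

lemma inner_sandwich: "u \<bullet> u = 1 \<Longrightarrow> ((u \<odot> x) \<odot> u) \<bullet> ((u \<odot> y) \<odot> u) = x \<bullet> y"
  by (simp add: inner_mul_right inner_mul_left)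

text \<open>Writing the test vector as \<open>t = u \<odot> s\<close> and taking the adjoint of the
  right factor produces \<open>(u \<odot> s) \<odot> (cj y \<odot> u)\<close>, a sandwich by
  \<open>moufang_middle\<close>. Sandwiching with a unit element is an isometry, so \<open>u\<close>
  drops out.\<close>

lemma moufang_left:
  assumes "u \<bullet> u = 1" shows "((u \<odot> x) \<odot> u) \<odot> (cj u \<odot> y) = u \<odot> (x \<odot> y)"
proof -
  have "(((u \<odot> x) \<odot> u) \<odot> (cj u \<odot> y)) \<bullet> t = (u \<odot> (x \<odot> y)) \<bullet> t" for t
  proof -
    define s where "s = cj u \<odot> t"
    have t: "t = u \<odot> s"
      using assms by (simp add: s_def mul_cj_cancel_left)
    have "(((u \<odot> x) \<odot> u) \<odot> (cj u \<odot> y)) \<bullet> t = ((u \<odot> x) \<odot> u) \<bullet> ((u \<odot> s) \<odot> (cj y \<odot> u))"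
      by (simp add: inner_mul_adjoint_right[of "(u \<odot> x) \<odot> u"] cj_mul t)
    also have "\<dots> = x \<bullet> (s \<odot> cj y)"
      by (simp add: moufang_middle inner_sandwich assms)
    also have "\<dots> = (u \<odot> (x \<odot> y)) \<bullet> t"
      by (simp add: t inner_mul_left assms inner_mul_adjoint_right[of x])
    finally show ?thesis .
  qed
  then show ?thesis using vector_eq_rdot by blast
qed

text \<open>The mirror image of \<open>moufang_left\<close> under \<open>cj\<close>, with
  \<open>cj u\<close> in place of \<open>u\<close>.\<close>

lemma moufang_right:
  assumes "u \<bullet> u = 1" shows "(x \<odot> cj u) \<odot> ((u \<odot> y) \<odot> u) = (x \<odot> y) \<odot> u"
proof -
  have "cj ((x \<odot> cj u) \<odot> ((u \<odot> y) \<odot> u)) = cj ((x \<odot> y) \<odot> u)"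
    using moufang_left[of "cj u" "cj y" "cj x"] assms
    by (simp add: cj_mul sandwich_assoc)
  then show ?thesis by (metis cj_cj)
qed

end

section \<open>Real numbers, complex numbers, quaternions and octonions as composition
  algebras\<close>

lemma composition_algebra_real: "composition_algebra (*) (\<lambda>x. x) (1::real)"
  by unfold_locales (auto simp: bilinear_def linear_iff algebra_simps abs_mult)

lemma composition_algebra_complex: "composition_algebra (*) cnj (1::complex)"
  by unfold_locales (auto simp: bilinear_def linear_iff algebra_simps norm_mult complex_eq_iff inner_complex_def)

lemma composition_algebra_double:
  assumes "composition_algebra mul cj e"
    and assoc: "\<And>x y z. mul (mul x y) z = mul x (mul y z)"
  shows "composition_algebra (cd_mult mul cj) (cd_cnj cj) (e, 0)"
proof -
  interpret composition_algebra mul cj e by fact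
  show ?thesis
  proof
    show "bilinear (cd_mult mul cj)"
      unfolding bilinear_def linear_iff
      by (auto simp: cd_mult_def mul_simps algebra_simps)
    show "cd_mult mul cj (e, 0) x = x" "cd_mult mul cj x (e, 0) = x" for x
      by (auto simp: cd_mult_def mul_simps)
    show "norm (e, 0::'a) = 1"
      by (simp add: norm_Pair)
    show "cd_cnj cj x = (2 * (x \<bullet> (e, 0))) *\<^sub>R (e, 0) - x" for x
      by (cases x) (simp add: cd_cnj_def cj_eq)
    show "norm (cd_mult mul cj x y) = norm x * norm y" for x y
    proof -
      obtain a b u v where xy: "x = (a, b)" "y = (u, v)" by fastforce
      \<comment> \<open>These are the two cross terms of the squared norm, which enter with opposite
        signs. Associativity of the algebra being doubled is used exactly here.\<close>
      have "mul a u \<bullet> mul (cj v) b = mul v a \<bullet> mul b (cj u)"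
        by (metis assoc cj_cj inner_commute inner_mul_adjoint_left inner_mul_adjoint_right)
      then have "cd_mult mul cj x y \<bullet> cd_mult mul cj x y = (x \<bullet> x) * (y \<bullet> y)"
        by (simp add: xy cd_mult_def inner_Pair inner_mul_self inner_commute algebra_simps)
      then show ?thesis
        by (simp add: norm_eq_sqrt_inner real_sqrt_mult)
    qed
  qed
qed

text \<open>Doubling a commutative associative algebra keeps associativity, which is what allows the
  second doubling.\<close>

lemma quat_mult_assoc: "quat_mult (quat_mult x y) z = quat_mult x (quat_mult y z)"
  by (simp add: quat_mult_def cd_mult_def algebra_simps)

lemma composition_algebra_quat: "composition_algebra quat_mult quat_cnj quat_one"
  unfolding quat_mult_def quat_cnj_def quat_one_def
  by (intro composition_algebra_double composition_algebra_complex) (simp add: mult.assoc)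

lemma composition_algebra_oct: "composition_algebra oct_mult oct_cnj oct_one"
  unfolding oct_mult_def oct_cnj_def oct_one_def
  by (intro composition_algebra_double composition_algebra_quat quat_mult_assoc)


section \<open>Linear isometries and spherical embeddings\<close>

text \<open>Linearity lets such a map act on differences of points of \<open>Q\<close>, which need
  not lie in \<open>Q\<close>, and makes it measurable.\<close>

definition linear_isometries :: "'a::euclidean_space set \<Rightarrow> ('a \<Rightarrow> 'a) set" where
  "linear_isometries Q = {T. orthogonal_transformation T \<and> T ` Q = Q}"

lemma linear_isometries_comp:
  "S \<in> linear_isometries Q \<Longrightarrow> T \<in> linear_isometries Q \<Longrightarrow> S \<circ> T \<in> linear_isometries Q"
  unfolding linear_isometries_def mem_Collect_eq image_comp [symmetric]
  by (simp add: orthogonal_transformation_compose)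

lemma id_linear_isometries: "(\<lambda>x. x) \<in> linear_isometries Q"
  unfolding linear_isometries_def by (auto simp: orthogonal_transformation linear_id[unfolded id_def])

lemma linear_isometries_mem: "T \<in> linear_isometries Q \<Longrightarrow> x \<in> Q \<Longrightarrow> T x \<in> Q"
  unfolding linear_isometries_def by auto

lemma linear_isometries_linear: "T \<in> linear_isometries Q \<Longrightarrow> linear T"
  unfolding linear_isometries_def by (auto simp: orthogonal_transformation_def)

lemma linear_isometries_inner: "T \<in> linear_isometries Q \<Longrightarrow> T x \<bullet> T y = x \<bullet> y"
  unfolding linear_isometries_def by (auto simp: orthogonal_transformation_def)

lemma linear_isometries_norm: "T \<in> linear_isometries Q \<Longrightarrow> norm (T x) = norm x"
  by (simp add: norm_eq_sqrt_inner linear_isometries_inner)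

lemma linear_isometries_inv:
  assumes "T \<in> linear_isometries Q" shows "inv T \<in> linear_isometries Q"
proof -
  from assms have T: "orthogonal_transformation T" "T ` Q = Q"
    by (auto simp: linear_isometries_def)
  then have "inv T ` Q = Q"
    using orthogonal_transformation_inj by (metis inv_into_image_cancel subset_UNIV)
  with T show ?thesis
    by (simp add: linear_isometries_def orthogonal_transformation_inv)
qed

lemma linear_isometriesI:
  assumes "linear T" "\<And>x. norm (T x) = norm x" "\<And>x. x \<in> Q \<Longrightarrow> T x \<in> Q"
    "\<And>x. x \<in> Q \<Longrightarrow> S x \<in> Q" "\<And>x. T (S x) = x"
  shows "T \<in> linear_isometries Q"
  using assms unfolding linear_isometries_def by (auto simp: orthogonal_transformation) (metis image_eqI)

text \<open>Here \<alpha> is 1 for the sphere and 2 for the projective spaces.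
  \<open>differences\<close> is the decisive condition: up to length and a linear isometry there is
  only one difference vector. \<open>two_points\<close> keeps the mean distances, and with them the
  denominator of \<gamma>(Q), away from zero.\<close>

locale spherical_embedding =
  fixes Q :: "'a::euclidean_space set" and \<theta> :: "'a \<Rightarrow> 'a \<Rightarrow> real" and \<alpha> :: real and A :: 'a
  assumes norm1: "x \<in> Q \<Longrightarrow> norm x = 1"
    and alpha_pos: "0 < \<alpha>"
    and theta_range: "x \<in> Q \<Longrightarrow> y \<in> Q \<Longrightarrow> 0 \<le> \<theta> x y \<and> \<theta> x y \<le> pi"
    and cos_theta: "x \<in> Q \<Longrightarrow> y \<in> Q \<Longrightarrow> cos (\<theta> x y) = 1 - \<alpha> * (1 - x \<bullet> y)"
    and transitive: "x \<in> Q \<Longrightarrow> y \<in> Q \<Longrightarrow> \<exists>T\<in>linear_isometries Q. T x = y"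
    and differences: "x \<in> Q \<Longrightarrow> y \<in> Q \<Longrightarrow> \<exists>T\<in>linear_isometries Q. T (x - y) = norm (x - y) *\<^sub>R A"
    and two_points: "\<exists>x\<in>Q. \<exists>y\<in>Q. x \<noteq> y"
begin

lemma theta_eq: "x \<in> Q \<Longrightarrow> y \<in> Q \<Longrightarrow> \<theta> x y = arccos (1 - \<alpha> * (1 - x \<bullet> y))"
  using theta_range cos_theta by (metis arccos_cos)

lemma theta_commute: "x \<in> Q \<Longrightarrow> y \<in> Q \<Longrightarrow> \<theta> x y = \<theta> y x"
  by (simp add: theta_eq inner_commute)

lemma theta_isometry:
  "T \<in> linear_isometries Q \<Longrightarrow> x \<in> Q \<Longrightarrow> y \<in> Q \<Longrightarrow> \<theta> (T x) (T y) = \<theta> x y"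
  by (simp add: theta_eq linear_isometries_mem linear_isometries_inner)

text \<open>Both sides are nonnegative with square \<open>\<alpha> (1 - x \<bullet> y) / 2\<close>:
  on the left by the half-angle formula, on the right because \<open>x\<close> and \<open>y\<close>
  are unit vectors.\<close>

lemma chordal_eq:
  assumes "x \<in> Q" "y \<in> Q" shows "chordal \<theta> x y = sqrt \<alpha> / 2 * norm (x - y)"
proof -
  have "(norm (x - y))\<^sup>2 = 2 * (1 - x \<bullet> y)"
    using norm1[OF assms(1)] norm1[OF assms(2)]
    by (simp add: power2_norm_eq_inner inner_diff norm_eq_1 inner_commute)
  moreover have "(sin (\<theta> x y / 2))\<^sup>2 = (1 - cos (\<theta> x y)) / 2"
    using cos_double_sin[of "\<theta> x y / 2"] by simp
  ultimately have "(sin (\<theta> x y / 2))\<^sup>2 = \<alpha> / 4 * (norm (x - y))\<^sup>2"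
    by (simp add: cos_theta[OF assms] right_diff_distrib)
  also have "\<dots> = (sqrt \<alpha> / 2 * norm (x - y))\<^sup>2"
    using alpha_pos by (simp add: power_mult_distrib power_divide)
  finally have "(sin (\<theta> x y / 2))\<^sup>2 = (sqrt \<alpha> / 2 * norm (x - y))\<^sup>2" .
  moreover have "0 \<le> sin (\<theta> x y / 2)"
    using theta_range[OF assms] by (intro sin_ge_zero) auto
  ultimately show ?thesis
    using alpha_pos by (simp add: chordal_def)
qed

end

section \<open>Integration against the invariant measure\<close>

locale invariant_embedding = spherical_embedding Q \<theta> \<alpha> A
  for Q :: "'a::euclidean_space set" and \<theta> \<alpha> A +
  fixes \<mu> :: "'a measure"
  assumes invariant: "invariant_measure Q \<theta> \<mu>"
begin

sublocale prob_space \<mu>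
  using invariant by (simp add: invariant_measure_def)

lemma sets_mu: "sets \<mu> = sets (restrict_space borel Q)"
  using invariant by (simp add: invariant_measure_def)

lemma space_mu: "space \<mu> = Q"
  using sets_eq_imp_space_eq[OF sets_mu] by (simp add: space_restrict_space)

lemma ident_measurable[measurable]: "(\<lambda>x. x) \<in> borel_measurable \<mu>"
  using measurable_ident_sets[OF sets_mu] measurable_restrict_space1[of "\<lambda>x. x" borel borel Q]
  by (simp add: measurable_cong_sets[OF sets_mu refl] id_def)

lemma measurable_into_borel: "f \<in> measurable M \<mu> \<Longrightarrow> f \<in> borel_measurable M"
  using measurable_compose[OF _ ident_measurable] by simp

lemma theta_measurable[measurable (raw)]:
  assumes f[measurable]: "f \<in> measurable M \<mu>" and g[measurable]: "g \<in> measurable M \<mu>"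
  shows "(\<lambda>w. \<theta> (f w) (g w)) \<in> borel_measurable M"
proof -
  note [measurable] = measurable_into_borel[OF f] measurable_into_borel[OF g]
  \<comment> \<open>\<open>arccos\<close> is continuous on the interval from -1 to 1. The argument
    is clamped to it; on \<open>Q\<close> it is a cosine and the clamp changes nothing.\<close>
  have "continuous_on UNIV (\<lambda>t::real. arccos (max (-1) (min 1 t)))"
    by (intro continuous_intros) auto
  then have [measurable]: "(\<lambda>t::real. arccos (max (-1) (min 1 t))) \<in> borel_measurable borel"
    by (rule borel_measurable_continuous_onI)
  have "(\<lambda>w. arccos (max (-1) (min 1 (1 - \<alpha> * (1 - f w \<bullet> g w))))) \<in> borel_measurable M"
    by measurable
  moreover have "\<theta> (f w) (g w) = arccos (max (-1) (min 1 (1 - \<alpha> * (1 - f w \<bullet> g w))))"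
    if "w \<in> space M" for w
  proof -
    have "f w \<in> Q" "g w \<in> Q"
      using that measurable_space[OF f] measurable_space[OF g] by (auto simp: space_mu)
    then show ?thesis
      using cos_theta[of "f w" "g w"] cos_le_one[of "\<theta> (f w) (g w)"]
        cos_ge_minus_one[of "\<theta> (f w) (g w)"] theta_eq[of "f w" "g w"] by simp
  qed
  ultimately show ?thesis
    by (subst measurable_cong)
qed

lemma isometry_measurable:
  assumes "T \<in> linear_isometries Q" shows "T \<in> measurable \<mu> \<mu>"
proof -
  have "T \<in> measurable (restrict_space borel Q) (restrict_space borel Q)"
    using assms linear_isometries_linear linear_continuous_on_compose
    by (intro measurable_restrict_space3 borel_measurable_continuous_onI)
      (auto intro: linear_continuous_on linear_linear[THEN iffD2] linear_isometries_mem
        simp: linear_conv_bounded_linear)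
  then show ?thesis
    by (simp add: measurable_cong_sets[OF sets_mu sets_mu])
qed

lemma integral_isometry:
  fixes h :: "'a \<Rightarrow> real"
  assumes T: "T \<in> linear_isometries Q" and h: "h \<in> borel_measurable \<mu>"
  shows "(LINT y|\<mu>. h (T y)) = (LINT y|\<mu>. h y)"
proof -
  have "bij_betw T Q Q"
    using T orthogonal_transformation_inj[of T] unfolding linear_isometries_def
    by (auto simp: bij_betw_def intro: inj_on_subset)
  then have "distr \<mu> \<mu> T = \<mu>"
    using invariant T theta_isometry by (auto simp: invariant_measure_def)
  then show ?thesis
    using integral_distr[OF isometry_measurable[OF T] h] by simp
qed

definition mean_abs_functional :: real where
  "mean_abs_functional = (LINT y|\<mu>. \<bar>A \<bullet> y\<bar>)"

text \<open>\<open>T\<close> preserves inner products, so it may be applied to both arguments;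
  invariance of \<mu> then removes it from \<open>y\<close>, and only the fixed direction
  \<open>A\<close> remains.\<close>

lemma integral_abs_difference:
  assumes "x \<in> Q" "x' \<in> Q"
  shows "(LINT y|\<mu>. \<bar>(x - x') \<bullet> y\<bar>) = norm (x - x') * mean_abs_functional"
proof -
  obtain T where T: "T \<in> linear_isometries Q" "T (x - x') = norm (x - x') *\<^sub>R A"
    using differences assms by blast
  have "(LINT y|\<mu>. \<bar>(x - x') \<bullet> y\<bar>) = (LINT y|\<mu>. \<bar>(norm (x - x') *\<^sub>R A) \<bullet> T y\<bar>)"
    using T linear_isometries_inner[OF T(1)] by metis
  also have "\<dots> = (LINT y|\<mu>. \<bar>(norm (x - x') *\<^sub>R A) \<bullet> y\<bar>)"
    by (rule integral_isometry[OF T(1)]) measurable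
  finally show ?thesis
    by (simp add: mean_abs_functional_def abs_mult)
qed

lemma bounded_integrable:
  assumes "(f :: 'a \<Rightarrow> real) \<in> borel_measurable \<mu>" "\<And>x. x \<in> Q \<Longrightarrow> \<bar>f x\<bar> \<le> B"
  shows "integrable \<mu> f"
  using assms by (intro integrable_const_bound[of _ B]) (auto simp: space_mu)

text \<open>If the mean vanished, almost every \<open>y\<close> would be orthogonal to any given
  difference of points, and some \<open>y\<close> in \<open>Q\<close> to all of them. For unit
  vectors \<open>(x - y) \<bullet> y = 0\<close> means \<open>x \<bullet> y = 1\<close>, so
  \<open>x = y\<close> and \<open>Q\<close> would be a single point.\<close>

lemma mean_abs_functional_pos: "0 < mean_abs_functional"
proof -
  have "mean_abs_functional \<noteq> 0"
  proof
    assume 0: "mean_abs_functional = 0"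
    define D where "D = (\<lambda>(x, x'). x - x') ` (Q \<times> Q)"
    \<comment> \<open>Each difference comes with its own null set. A basis chosen among the
      differences leaves finitely many, whose null sets can be united.\<close>
    obtain B where B: "B \<subseteq> D" "independent B" "D \<subseteq> span B"
      using basis_exists[of D] by metis
    have "finite B"
      using B(2) by (rule independent_imp_finite)
    have "AE y in \<mu>. b \<bullet> y = 0" if "b \<in> B" for b
    proof -
      obtain x x' where x: "x \<in> Q" "x' \<in> Q" "b = x - x'"
        using \<open>b \<in> B\<close> B(1) by (auto simp: D_def)
      have "integrable \<mu> (\<lambda>y. \<bar>b \<bullet> y\<bar>)"
        by (rule bounded_integrable[where B = "norm b"])
          (measurable, metis Cauchy_Schwarz_ineq2 abs_idempotent mult.right_neutral norm1)
      moreover have "(LINT y|\<mu>. \<bar>b \<bullet> y\<bar>) = 0"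
        using integral_abs_difference[OF x(1,2)] x(3) 0 by simp
      ultimately show ?thesis
        using integral_nonneg_eq_0_iff_AE[of \<mu> "\<lambda>y. \<bar>b \<bullet> y\<bar>"] by simp
    qed
    then have "AE y in \<mu>. \<forall>b\<in>B. b \<bullet> y = 0"
      using \<open>finite B\<close> by (simp add: AE_finite_all)
    then have "\<exists>y\<in>Q. \<forall>b\<in>B. b \<bullet> y = 0"
    proof (rule contrapos_pp)
      assume "\<not> (\<exists>y\<in>Q. \<forall>b\<in>B. b \<bullet> y = 0)"
      then have "(AE y in \<mu>. \<forall>b\<in>B. b \<bullet> y = 0) \<longleftrightarrow> (AE y in \<mu>. False)"
        by (intro AE_cong) (auto simp: space_mu)
      then show "\<not> (AE y in \<mu>. \<forall>b\<in>B. b \<bullet> y = 0)"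
        using AE_const[of False] by blast
    qed
    then obtain y where y: "y \<in> Q" "\<And>b. b \<in> B \<Longrightarrow> b \<bullet> y = 0" by blast
    have orth: "(x - y) \<bullet> y = 0" if "x \<in> Q" for x
    proof -
      have "x - y \<in> span B"
        using that y(1) B(3) by (auto simp: D_def)
      moreover have "orthogonal y b" if "b \<in> B" for b
        using y(2)[OF that] by (simp add: orthogonal_def inner_commute)
      ultimately have "orthogonal y (x - y)"
        by (rule orthogonal_to_span)
      then show ?thesis
        by (simp add: orthogonal_def inner_commute)
    qed
    have "x = y" if "x \<in> Q" for x
    proof -
      have "(norm (x - y))\<^sup>2 = 0"
        using orth[OF that] norm1[OF that] norm1[OF y(1)]
        by (simp add: power2_norm_eq_inner inner_diff norm_eq_1 inner_commute)
      then show ?thesis by simp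
    qed
    then show False
      using two_points by blast
  qed
  moreover have "0 \<le> mean_abs_functional"
    by (simp add: mean_abs_functional_def)
  ultimately show ?thesis by simp
qed

end


section \<open>The invariance principle\<close>

text \<open>Packaging the weight as a finite measure, of total mass 2, makes Fubini's theorem
  available for integrals over \<open>r\<close> and \<open>y\<close>. The indicator restricts to the
  interval where \<open>sin\<close> is nonnegative.\<close>

definition sin_measure :: "real measure" where
  "sin_measure = density lborel (\<lambda>r. ennreal (indicator {0..pi} r * sin r))"

lemma sets_sin_measure[measurable_cong]: "sets sin_measure = sets borel"
  by (simp add: sin_measure_def)

lemma integral_sin_measure:
  fixes f :: "real \<Rightarrow> real"
  assumes "f \<in> borel_measurable borel"
  shows "(LINT r|sin_measure. f r) = (LINT r:{0..pi}|lborel. f r * sin r)"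
proof -
  have "(LINT r|sin_measure. f r) = (LINT r|lborel. (indicator {0..pi} r * sin r) * f r)"
    unfolding sin_measure_def using assms
    by (intro integral_real_density) (auto simp: indicator_def sin_ge_zero)
  then show ?thesis
    by (simp add: set_lebesgue_integral_def mult_ac)
qed

lemma emeasure_sin_measure_interval:
  assumes "0 \<le> a" "a \<le> b" "b \<le> pi"
  shows "emeasure sin_measure {a<..b} = ennreal (cos a - cos b)"
proof -
  have "emeasure sin_measure {a<..b}
      = (\<integral>\<^sup>+r. ennreal (indicator {0..pi} r * sin r) * indicator {a<..b} r \<partial>lborel)"
    by (simp add: sin_measure_def emeasure_density)
  \<comment> \<open>The endpoint \<open>a\<close> is a null set, so the interval may be closed
    before the fundamental theorem of calculus is applied.\<close>
  also have "\<dots> = (\<integral>\<^sup>+r. ennreal (sin r) * indicator {a..b} r \<partial>lborel)"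
    using assms AE_lborel_singleton[of a]
    by (intro nn_integral_cong_AE) (auto simp: indicator_def elim!: eventually_mono)
  also have "\<dots> = ennreal (- cos b - - cos a)"
    using assms by (intro nn_integral_FTC_Icc) (auto intro!: derivative_eq_intros sin_ge_zero)
  finally show ?thesis by simp
qed

lemma emeasure_sin_measure_UNIV: "emeasure sin_measure UNIV = 2"
proof -
  have "emeasure sin_measure UNIV
      = (\<integral>\<^sup>+r. ennreal (indicator {0..pi} r * sin r) \<partial>lborel)"
    by (simp add: sin_measure_def emeasure_density)
  also have "\<dots> = (\<integral>\<^sup>+r. ennreal (sin r) * indicator {0..pi} r \<partial>lborel)"
    by (intro nn_integral_cong) (auto simp: indicator_def)
  also have "\<dots> = ennreal (- cos pi - - cos 0)"
    by (intro nn_integral_FTC_Icc) (auto intro!: derivative_eq_intros sin_ge_zero)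
  finally show ?thesis by simp
qed

interpretation sin_measure: finite_measure sin_measure
  by standard (use emeasure_sin_measure_UNIV in \<open>simp add: sin_measure_def\<close>)

text \<open>For \<open>s \<le> t\<close> the integrand is the indicator of \<open>{s<..t}\<close>,
  half-open because balls are defined by a strict inequality.\<close>

lemma integral_sin_measure_between:
  fixes s t :: real
  assumes "0 \<le> s" "s \<le> pi" "0 \<le> t" "t \<le> pi"
  shows "(LINT r|sin_measure. \<bar>of_bool (s < r) - of_bool (t < r) :: real\<bar>) = \<bar>cos s - cos t\<bar>"
  using assms
proof (induction s t rule: linorder_wlog)
  case (le s t)
  have "(LINT r|sin_measure. \<bar>of_bool (s < r) - of_bool (t < r) :: real\<bar>)
      = (LINT r|sin_measure. indicator {s<..t} r)"
    using le by (intro Bochner_Integration.integral_cong) (auto simp: indicator_def)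
  also have "\<dots> = cos s - cos t"
    using le emeasure_sin_measure_interval[of s t] cos_mono_le_eq[of t s]
    by (simp add: measure_def sin_measure_def)
  finally show ?case
    using le cos_mono_le_eq[of t s] by simp
next
  case (sym s t)
  then show ?case by (simp add: abs_minus_commute)
qed

lemma sum_mset_mset_nth: "(\<Sum>x\<in>#mset xs. f x) = (\<Sum>i<length xs. f (xs ! i))"
  by (simp add: sum_mset_sum_list sum_list_sum_nth atLeast0LessThan flip: mset_map)

lemma distance_sum_mset:
  "distance_sum \<rho> (mset xs) = (\<Sum>i<length xs. \<Sum>j<length xs. \<rho> (xs ! i) (xs ! j))"
  by (simp add: distance_sum_def sum_mset_mset_nth)

section \<open>Volumes, overlaps and symmetric differences of balls\<close>

context invariant_embedding
begin

definition ball_indicator :: "real \<Rightarrow> 'a \<Rightarrow> 'a \<Rightarrow> real" where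
  "ball_indicator r x y = of_bool (\<theta> x y < r)"

lemma ball_indicator_measurable[measurable (raw)]:
  assumes [measurable]: "f \<in> measurable M \<mu>" "g \<in> measurable M \<mu>" "h \<in> borel_measurable M"
  shows "(\<lambda>w. ball_indicator (h w) (f w) (g w)) \<in> borel_measurable M"
  unfolding ball_indicator_def by measurable

lemma ball_indicator_nonneg: "0 \<le> ball_indicator r x y"
  by (simp add: ball_indicator_def)

lemma ball_indicator_commute: "x \<in> Q \<Longrightarrow> y \<in> Q \<Longrightarrow> ball_indicator r x y = ball_indicator r y x"
  by (simp add: ball_indicator_def theta_commute)

definition ball_volume :: "real \<Rightarrow> real" where
  "ball_volume r = measure \<mu> (metric_ball \<theta> \<mu> r (SOME y. y \<in> Q))"

lemma metric_ball_sets: "y \<in> Q \<Longrightarrow> metric_ball \<theta> \<mu> r y \<in> sets \<mu>"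
  unfolding metric_ball_def by (measurable; simp add: space_mu)

lemma integral_ball_indicator:
  assumes "y \<in> Q"
  shows "(LINT x|\<mu>. ball_indicator r x y) = measure \<mu> (metric_ball \<theta> \<mu> r y)"
proof -
  have "(LINT x|\<mu>. ball_indicator r x y) = (LINT x|\<mu>. indicator (metric_ball \<theta> \<mu> r y) x)"
    by (intro Bochner_Integration.integral_cong)
      (auto simp: ball_indicator_def metric_ball_def indicator_def)
  then show ?thesis
    using metric_ball_sets[OF assms] by simp
qed

text \<open>A linear isometry carries the centre \<open>y\<close> to the chosen one and preserves
  \<theta>, hence identifies the two ball indicators; \<mu> is invariant under it.\<close>

lemma measure_metric_ball:
  assumes "y \<in> Q" shows "measure \<mu> (metric_ball \<theta> \<mu> r y) = ball_volume r"
proof -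
  define z where "z = (SOME y. y \<in> Q)"
  have z: "z \<in> Q" unfolding z_def using assms by (rule someI)
  obtain T where T: "T \<in> linear_isometries Q" "T y = z"
    using transitive assms z by blast
  have "(LINT x|\<mu>. ball_indicator r x y) = (LINT x|\<mu>. ball_indicator r (T x) (T y))"
    using T assms by (intro Bochner_Integration.integral_cong)
      (auto simp: ball_indicator_def theta_isometry space_mu)
  also have "\<dots> = (LINT x|\<mu>. ball_indicator r x z)"
    unfolding T(2) using z
    by (intro integral_isometry[OF T(1)]) (measurable; simp add: space_mu)
  finally show ?thesis
    using assms z by (simp add: integral_ball_indicator ball_volume_def z_def)
qed

lemma integral_ball_indicator_left: "y \<in> Q \<Longrightarrow> (LINT x|\<mu>. ball_indicator r x y) = ball_volume r"
  by (simp add: integral_ball_indicator measure_metric_ball)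

lemma integral_ball_indicator_right:
  assumes "x \<in> Q" shows "(LINT y|\<mu>. ball_indicator r x y) = ball_volume r"
  unfolding integral_ball_indicator_left[OF assms, symmetric] using assms
  by (intro Bochner_Integration.integral_cong) (auto simp: ball_indicator_commute space_mu)

definition ball_overlap :: "real \<Rightarrow> 'a \<Rightarrow> 'a \<Rightarrow> real" where
  "ball_overlap r x x' = (LINT y|\<mu>. ball_indicator r x y * ball_indicator r x' y)"

lemma const_measurable: "x \<in> Q \<Longrightarrow> (\<lambda>_. x) \<in> measurable M \<mu>"
  by (simp add: space_mu)

lemma ball_overlap_measurable[measurable (raw)]:
  assumes [measurable]: "f \<in> measurable M \<mu>" "g \<in> measurable M \<mu>" "h \<in> borel_measurable M"
  shows "(\<lambda>w. ball_overlap (h w) (f w) (g w)) \<in> borel_measurable M"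
  unfolding ball_overlap_def by measurable

lemma ball_overlap_bound: "0 \<le> ball_overlap r x x'" "x \<in> Q \<Longrightarrow> x' \<in> Q \<Longrightarrow> ball_overlap r x x' \<le> 1"
proof -
  show "0 \<le> ball_overlap r x x'"
    unfolding ball_overlap_def by (intro Bochner_Integration.integral_nonneg) (simp add: ball_indicator_nonneg)
  assume [measurable]: "x \<in> Q" "x' \<in> Q"
  note [measurable] = const_measurable[OF \<open>x \<in> Q\<close>] const_measurable[OF \<open>x' \<in> Q\<close>]
  have "ball_overlap r x x' \<le> (LINT y|\<mu>. 1)"
    unfolding ball_overlap_def
    by (intro integral_mono bounded_integrable[where B = 1])
      (auto simp: ball_indicator_def)
  then show "ball_overlap r x x' \<le> 1"
    by (simp add: prob_space)
qed

lemma ball_volume_measurable[measurable]: "ball_volume \<in> borel_measurable borel"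
proof -
  obtain y where y: "y \<in> Q" using two_points by blast
  note [measurable] = const_measurable[OF y]
  have "(\<lambda>r. LINT x|\<mu>. ball_indicator r x y) \<in> borel_measurable borel"
    by measurable
  then show ?thesis
    by (simp add: integral_ball_indicator_left[OF y])
qed

lemma ball_volume_bound: "0 \<le> ball_volume r" "ball_volume r \<le> 1"
  by (auto simp: ball_volume_def)

lemma symdiff_metric_at_eq_integral:
  assumes "x \<in> Q" "x' \<in> Q"
  shows "symdiff_metric_at \<theta> \<mu> r x x'
    = (LINT y|\<mu>. \<bar>ball_indicator r x y - ball_indicator r x' y\<bar>) / 2"
proof -
  let ?S = "sym_diff (metric_ball \<theta> \<mu> r x) (metric_ball \<theta> \<mu> r x')"
  have "(LINT y|\<mu>. \<bar>ball_indicator r x y - ball_indicator r x' y\<bar>) = (LINT y|\<mu>. indicator ?S y)"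
    using assms by (intro Bochner_Integration.integral_cong)
      (auto simp: ball_indicator_def metric_ball_def indicator_def theta_commute space_mu)
  then show ?thesis
    using metric_ball_sets[OF assms(1)] metric_ball_sets[OF assms(2)]
    by (simp add: symdiff_metric_at_def)
qed

lemma ball_indicator_integrable: "x \<in> Q \<Longrightarrow> integrable \<mu> (ball_indicator r x)"
  using const_measurable[of x \<mu>, measurable]
  by (intro bounded_integrable[where B = 1]) (auto simp: ball_indicator_def)

lemma ball_indicator_mult_integrable:
  "x \<in> Q \<Longrightarrow> x' \<in> Q \<Longrightarrow> integrable \<mu> (\<lambda>y. ball_indicator r x y * ball_indicator r x' y)"
  using const_measurable[of x \<mu>, measurable] const_measurable[of x' \<mu>, measurable]
  by (intro bounded_integrable[where B = 1]) (auto simp: ball_indicator_def)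

text \<open>For indicators, \<open>\<bar>a - b\<bar> = a + b - 2 a b\<close>. Both balls have the
  volume \<open>ball_volume r\<close>, and the factor one half in the definition cancels the
  two.\<close>

lemma symdiff_metric_at_eq:
  assumes "x \<in> Q" "x' \<in> Q"
  shows "symdiff_metric_at \<theta> \<mu> r x x' = ball_volume r - ball_overlap r x x'"
proof -
  note [measurable] = const_measurable[OF assms(1)] const_measurable[OF assms(2)]
  have "(LINT y|\<mu>. \<bar>ball_indicator r x y - ball_indicator r x' y\<bar>)
      = (LINT y|\<mu>. ball_indicator r x y + ball_indicator r x' y
          - 2 * (ball_indicator r x y * ball_indicator r x' y))"
    by (intro Bochner_Integration.integral_cong) (auto simp: ball_indicator_def)
  also have "\<dots> = ball_volume r + ball_volume r - 2 * ball_overlap r x x'"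
    unfolding ball_overlap_def
    using assms
    by (simp add: integral_ball_indicator_right ball_indicator_integrable
        ball_indicator_mult_integrable)
  finally show ?thesis
    by (simp add: symdiff_metric_at_eq_integral assms)
qed

text \<open>The integrals over \<open>r\<close> and \<open>y\<close> are exchanged by Fubini's
  theorem. The factor \<open>sqrt \<alpha>\<close> is what remains of \<open>\<alpha> / 2\<close>
  once \<open>sqrt \<alpha> / 2\<close> is absorbed into the chordal metric.\<close>

lemma symdiff_metric_eq_chordal:
  assumes "x \<in> Q" "x' \<in> Q"
  shows "symdiff_metric \<theta> \<mu> sin x x' = sqrt \<alpha> * mean_abs_functional * chordal \<theta> x x'"
proof -
  note [measurable] = const_measurable[OF assms(1)] const_measurable[OF assms(2)]
  interpret pair_sigma_finite sin_measure \<mu> ..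
  interpret P: finite_measure "sin_measure \<Otimes>\<^sub>M \<mu>"
    by (intro finite_measure_pair_measure sin_measure.finite_measure_axioms finite_measure_axioms)
  have meas: "(\<lambda>r. symdiff_metric_at \<theta> \<mu> r x x') \<in> borel_measurable borel"
    by (simp add: symdiff_metric_at_eq assms)
  have "symdiff_metric \<theta> \<mu> sin x x' = (LINT r|sin_measure. symdiff_metric_at \<theta> \<mu> r x x')"
    by (simp add: symdiff_metric_def integral_sin_measure meas)
  also have "\<dots> = (LINT r|sin_measure. (LINT y|\<mu>. \<bar>ball_indicator r x y - ball_indicator r x' y\<bar>)) / 2"
    by (simp add: symdiff_metric_at_eq_integral assms)
  also have "(LINT r|sin_measure. (LINT y|\<mu>. \<bar>ball_indicator r x y - ball_indicator r x' y\<bar>))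
      = (LINT y|\<mu>. (LINT r|sin_measure. \<bar>ball_indicator r x y - ball_indicator r x' y\<bar>))"
    by (rule Fubini_integral[symmetric], rule P.integrable_const_bound[of _ 1])
      (auto simp: ball_indicator_def)
  also have "\<dots> = (LINT y|\<mu>. \<alpha> * \<bar>(x - x') \<bullet> y\<bar>)"
  proof (intro Bochner_Integration.integral_cong refl)
    fix y assume "y \<in> space \<mu>"
    then have y: "y \<in> Q" by (simp add: space_mu)
    have "(LINT r|sin_measure. \<bar>ball_indicator r x y - ball_indicator r x' y\<bar>)
        = \<bar>cos (\<theta> x y) - cos (\<theta> x' y)\<bar>"
      unfolding ball_indicator_def
      using theta_range assms y by (intro integral_sin_measure_between) auto
    also have "\<dots> = \<bar>\<alpha> * ((x - x') \<bullet> y)\<bar>"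
      using assms y by (simp add: cos_theta algebra_simps inner_diff_left)
    finally show "(LINT r|sin_measure. \<bar>ball_indicator r x y - ball_indicator r x' y\<bar>)
        = \<alpha> * \<bar>(x - x') \<bullet> y\<bar>"
      using alpha_pos by (simp add: abs_mult)
  qed
  also have "\<dots> = \<alpha> * (norm (x - x') * mean_abs_functional)"
    using integral_abs_difference[OF assms] by simp
  finally show ?thesis
    using alpha_pos by (simp add: chordal_eq assms)
qed

end

lemma size_filter_mset_eq_sum: "real (size (filter_mset P D)) = (\<Sum>x\<in>#D. of_bool (P x))"
  by (induction D) auto

lemma integral_double_sum:
  fixes f :: "nat \<Rightarrow> nat \<Rightarrow> 'b \<Rightarrow> real"
  assumes "\<And>i j. i < n \<Longrightarrow> j < n \<Longrightarrow> integrable M (f i j)"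
  shows "(LINT y|M. (\<Sum>i<n. \<Sum>j<n. f i j y)) = (\<Sum>i<n. \<Sum>j<n. LINT y|M. f i j y)"
proof -
  have "(LINT y|M. (\<Sum>i<n. \<Sum>j<n. f i j y)) = (\<Sum>i<n. LINT y|M. (\<Sum>j<n. f i j y))"
    using assms by (intro Bochner_Integration.integral_sum Bochner_Integration.integrable_sum) auto
  also have "\<dots> = (\<Sum>i<n. \<Sum>j<n. LINT y|M. f i j y)"
    using assms by (intro sum.cong refl Bochner_Integration.integral_sum) auto
  finally show ?thesis .
qed

section \<open>The mean square discrepancy as a sum of covariances\<close>

context invariant_embedding
begin

lemma sin_measure_integrable:
  assumes "(f :: real \<Rightarrow> real) \<in> borel_measurable borel" "\<And>r. \<bar>f r\<bar> \<le> B"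
  shows "integrable sin_measure f"
  using assms by (intro sin_measure.integrable_const_bound[of _ B]) (auto simp: sin_measure_def)

text \<open>Distributing the expected number of points, \<open>ball_volume r\<close> to each point,
  makes the discrepancy a sum of centred indicators; its mean square is then a sum of
  covariances.\<close>

lemma ball_discrepancy_mset:
  assumes "set xs \<subseteq> Q" "y \<in> Q"
  shows "ball_discrepancy \<theta> \<mu> r y (mset xs)
    = (\<Sum>i<length xs. ball_indicator r (xs ! i) y - ball_volume r)"
proof -
  have "real (size {#x \<in># mset xs. x \<in> metric_ball \<theta> \<mu> r y#})
      = (\<Sum>i<length xs. of_bool (xs ! i \<in> metric_ball \<theta> \<mu> r y))"
    by (simp add: size_filter_mset_eq_sum sum_mset_mset_nth del: mset_filter)
  also have "\<dots> = (\<Sum>i<length xs. ball_indicator r (xs ! i) y)"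
    using assms nth_mem by (intro sum.cong) (auto simp: metric_ball_def ball_indicator_def space_mu)
  finally show ?thesis
    using assms by (simp add: ball_discrepancy_def measure_metric_ball sum_subtractf)
qed

lemma covariance_ball_indicator:
  assumes "x \<in> Q" "x' \<in> Q"
  shows "(LINT y|\<mu>. (ball_indicator r x y - ball_volume r) * (ball_indicator r x' y - ball_volume r))
    = ball_overlap r x x' - (ball_volume r)\<^sup>2"
proof -
  let ?v = "ball_volume r"
  have "(LINT y|\<mu>. (ball_indicator r x y - ?v) * (ball_indicator r x' y - ?v))
     = (LINT y|\<mu>. ball_indicator r x y * ball_indicator r x' y - ?v * ball_indicator r x y
          - ?v * ball_indicator r x' y + ?v\<^sup>2)"
    by (simp add: algebra_simps power2_eq_square)
  also have "\<dots> = ball_overlap r x x' - ?v * ?v - ?v * ?v + ?v\<^sup>2"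
    unfolding ball_overlap_def using assms
    by (simp add: integral_ball_indicator_right ball_indicator_integrable
        ball_indicator_mult_integrable prob_space)
  finally show ?thesis by (simp add: power2_eq_square)
qed

lemma discrepancy_at_mset:
  assumes "set xs \<subseteq> Q"
  shows "discrepancy_at \<theta> \<mu> r (mset xs)
    = (\<Sum>i<length xs. \<Sum>j<length xs. ball_overlap r (xs ! i) (xs ! j) - (ball_volume r)\<^sup>2)"
proof -
  let ?f = "\<lambda>i y. ball_indicator r (xs ! i) y - ball_volume r"
  have Q: "xs ! i \<in> Q" if "i < length xs" for i
    using assms that by auto
  have int: "integrable \<mu> (\<lambda>y. ?f i y * ?f j y)" if "i < length xs" "j < length xs" for i j
  proof -
    note [measurable] = const_measurable[OF Q[OF that(1)]] const_measurable[OF Q[OF that(2)]]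
    have "\<bar>?f i y * ?f j y\<bar> \<le> 1 * 1" for y
      unfolding abs_mult using ball_volume_bound[of r]
      by (intro mult_mono) (auto simp: ball_indicator_def)
    then show ?thesis
      by (intro bounded_integrable[where B = "1 * 1"]) auto
  qed
  have "discrepancy_at \<theta> \<mu> r (mset xs)
      = (LINT y|\<mu>. (\<Sum>i<length xs. \<Sum>j<length xs. ?f i y * ?f j y))"
    unfolding discrepancy_at_def using assms
    by (intro Bochner_Integration.integral_cong refl)
      (simp add: ball_discrepancy_mset space_mu power2_eq_square sum_product)
  also have "\<dots> = (\<Sum>i<length xs. \<Sum>j<length xs. LINT y|\<mu>. ?f i y * ?f j y)"
    using int by (rule integral_double_sum)
  also have "\<dots> = (\<Sum>i<length xs. \<Sum>j<length xs. ball_overlap r (xs ! i) (xs ! j) - (ball_volume r)\<^sup>2)"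
    using Q by (intro sum.cong) (auto simp: covariance_ball_indicator)
  finally show ?thesis .
qed

text \<open>The variance of the indicator of a ball, integrated over \<open>r\<close>. By
  \<open>mean_symdiff_metric\<close> this is also the mean of the symmetric difference
  metric.\<close>

definition mean_variance :: real where
  "mean_variance = (LINT r|sin_measure. ball_volume r - (ball_volume r)\<^sup>2)"

lemma ball_volume_square_bound: "(ball_volume r)\<^sup>2 \<le> ball_volume r"
  using ball_volume_bound[of r] by (simp add: power2_eq_square mult_left_le_one_le)

lemma symdiff_metric_eq_integral:
  assumes "x \<in> Q" "x' \<in> Q"
  shows "symdiff_metric \<theta> \<mu> sin x x' = (LINT r|sin_measure. ball_volume r - ball_overlap r x x')"
  using assms const_measurable[of x borel, measurable] const_measurable[of x' borel, measurable]
  by (simp add: symdiff_metric_def symdiff_metric_at_eq integral_sin_measure)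

text \<open>With \<open>v\<close> the ball volume, the integrand is the variance
  \<open>v - v^2\<close>, which is the same for all pairs of points, minus
  \<open>v - overlap\<close>, which integrates to the symmetric difference metric.\<close>

lemma integral_overlap_minus_square:
  assumes "x \<in> Q" "x' \<in> Q"
  shows "(LINT r|sin_measure. ball_overlap r x x' - (ball_volume r)\<^sup>2)
      = mean_variance - symdiff_metric \<theta> \<mu> sin x x'"
    "integrable sin_measure (\<lambda>r. ball_overlap r x x' - (ball_volume r)\<^sup>2)"
proof -
  note [measurable] = const_measurable[OF assms(1)] const_measurable[OF assms(2)]
  have b: "\<bar>ball_volume r - (ball_volume r)\<^sup>2\<bar> \<le> 1" "\<bar>ball_volume r - ball_overlap r x x'\<bar> \<le> 1"
    "\<bar>ball_overlap r x x' - (ball_volume r)\<^sup>2\<bar> \<le> 1" for r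
    using ball_volume_bound[of r] ball_volume_square_bound[of r] zero_le_power2[of "ball_volume r"]
      ball_overlap_bound(1)[of r x x'] ball_overlap_bound(2)[OF assms, of r]
    by linarith+
  have int: "integrable sin_measure (\<lambda>r. ball_volume r - (ball_volume r)\<^sup>2)"
    "integrable sin_measure (\<lambda>r. ball_volume r - ball_overlap r x x')"
    "integrable sin_measure (\<lambda>r. ball_overlap r x x' - (ball_volume r)\<^sup>2)"
    by (rule sin_measure_integrable[OF _ b(1)] sin_measure_integrable[OF _ b(2)]
        sin_measure_integrable[OF _ b(3)], measurable)+
  then show "integrable sin_measure (\<lambda>r. ball_overlap r x x' - (ball_volume r)\<^sup>2)"
    by simp
  show "(LINT r|sin_measure. ball_overlap r x x' - (ball_volume r)\<^sup>2)
      = mean_variance - symdiff_metric \<theta> \<mu> sin x x'"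
    unfolding mean_variance_def symdiff_metric_eq_integral[OF assms]
      Bochner_Integration.integral_diff[OF int(1,2), symmetric] by simp
qed

text \<open>This is the invariance principle for the symmetric difference metric, reached before any
  comparison with the chordal metric. The constant arises once for each ordered pair of indices,
  diagonal included.\<close>

lemma discrepancy_mset:
  assumes "set xs \<subseteq> Q"
  shows "discrepancy \<theta> \<mu> sin (mset xs)
    = mean_variance * (real (length xs))\<^sup>2 - distance_sum (symdiff_metric \<theta> \<mu> sin) (mset xs)"
proof -
  have Q: "xs ! i \<in> Q" if "i < length xs" for i
    using assms that by auto
  let ?g = "\<lambda>i j r. ball_overlap r (xs ! i) (xs ! j) - (ball_volume r)\<^sup>2"
  have int: "integrable sin_measure (?g i j)" if "i < length xs" "j < length xs" for i j
    using integral_overlap_minus_square(2) Q that by blast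
  have "(\<lambda>r. \<Sum>i<length xs. \<Sum>j<length xs. ?g i j r) \<in> borel_measurable borel"
    using borel_measurable_integrable[OF int]
    by (intro borel_measurable_sum) (auto simp: sin_measure_def)
  then have "discrepancy \<theta> \<mu> sin (mset xs)
      = (LINT r|sin_measure. (\<Sum>i<length xs. \<Sum>j<length xs. ?g i j r))"
    by (simp add: discrepancy_def discrepancy_at_mset[OF assms] integral_sin_measure)
  also have "\<dots> = (\<Sum>i<length xs. \<Sum>j<length xs. LINT r|sin_measure. ?g i j r)"
    using int by (rule integral_double_sum)
  also have "\<dots> = (\<Sum>i<length xs. \<Sum>j<length xs.
      mean_variance - symdiff_metric \<theta> \<mu> sin (xs ! i) (xs ! j))"
    using Q by (intro sum.cong) (auto simp: integral_overlap_minus_square)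
  finally show ?thesis
    by (simp add: distance_sum_mset sum_subtractf power2_eq_square)
qed

text \<open>Integrating over \<open>x'\<close> first replaces the second indicator by the ball
  volume, whatever \<open>y\<close> is.\<close>

lemma integral_ball_overlap:
  assumes "x \<in> Q" shows "(LINT x'|\<mu>. ball_overlap r x x') = (ball_volume r)\<^sup>2"
proof -
  note [measurable] = const_measurable[OF assms]
  interpret pair_prob_space \<mu> \<mu> ..
  have "(LINT x'|\<mu>. ball_overlap r x x')
      = (LINT y|\<mu>. (LINT x'|\<mu>. ball_indicator r x y * ball_indicator r x' y))"
    unfolding ball_overlap_def
    by (rule Fubini_integral[symmetric], rule P.integrable_const_bound[of _ 1])
      (auto simp: ball_indicator_def)
  also have "\<dots> = (LINT y|\<mu>. ball_indicator r x y * ball_volume r)"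
    by (intro Bochner_Integration.integral_cong) (auto simp: integral_ball_indicator_left space_mu)
  also have "\<dots> = (ball_volume r)\<^sup>2"
    using assms by (simp add: integral_ball_indicator_right power2_eq_square)
  finally show ?thesis .
qed

text \<open>Averaging over one point turns the overlap into \<open>v^2\<close> and so produces the
  variance. The result does not depend on \<open>x\<close>, which identifies the constant of
  \<open>discrepancy_mset\<close> with the mean of the metric.\<close>

lemma integral_symdiff_metric:
  assumes "x \<in> Q" shows "(LINT x'|\<mu>. symdiff_metric \<theta> \<mu> sin x x') = mean_variance"
proof -
  note [measurable] = const_measurable[OF assms]
  interpret pair_sigma_finite sin_measure \<mu> ..
  interpret P: finite_measure "sin_measure \<Otimes>\<^sub>M \<mu>"
    by (intro finite_measure_pair_measure sin_measure.finite_measure_axioms finite_measure_axioms)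
  have b: "\<bar>ball_volume r - ball_overlap r x x'\<bar> \<le> 1" if "x' \<in> Q" for r x'
    using ball_volume_bound[of r] ball_overlap_bound(1)[of r x x']
      ball_overlap_bound(2)[OF assms that, of r] by linarith
  have "(LINT x'|\<mu>. symdiff_metric \<theta> \<mu> sin x x')
      = (LINT x'|\<mu>. (LINT r|sin_measure. ball_volume r - ball_overlap r x x'))"
    using assms
    by (intro Bochner_Integration.integral_cong) (auto simp: symdiff_metric_eq_integral space_mu)
  also have "\<dots> = (LINT r|sin_measure. (LINT x'|\<mu>. ball_volume r - ball_overlap r x x'))"
    by (rule Fubini_integral, rule P.integrable_const_bound[of _ 1])
      (use b in \<open>auto simp: space_pair_measure space_mu\<close>)
  also have "\<dots> = mean_variance"
    unfolding mean_variance_def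
  proof (intro Bochner_Integration.integral_cong refl)
    fix r
    have "integrable \<mu> (\<lambda>x'. ball_overlap r x x')"
      using ball_overlap_bound assms by (intro bounded_integrable[where B = 1]) auto
    then show "(LINT x'|\<mu>. ball_volume r - ball_overlap r x x') = ball_volume r - (ball_volume r)\<^sup>2"
      using assms by (simp add: integral_ball_overlap prob_space)
  qed
  finally show ?thesis .
qed

lemma mean_symdiff_metric: "mean_distance \<mu> (symdiff_metric \<theta> \<mu> sin) = mean_variance"
proof -
  have "mean_distance \<mu> (symdiff_metric \<theta> \<mu> sin) = (LINT x|\<mu>. mean_variance)"
    unfolding mean_distance_def
    by (intro Bochner_Integration.integral_cong) (auto simp: integral_symdiff_metric space_mu)
  then show ?thesis by (simp add: prob_space)
qed

definition symdiff_ratio :: real where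
  "symdiff_ratio = sqrt \<alpha> * mean_abs_functional"

lemma symdiff_ratio_pos: "0 < symdiff_ratio"
  using alpha_pos mean_abs_functional_pos by (simp add: symdiff_ratio_def)

lemma symdiff_metric_eq:
  "x \<in> Q \<Longrightarrow> x' \<in> Q \<Longrightarrow> symdiff_metric \<theta> \<mu> sin x x' = symdiff_ratio * chordal \<theta> x x'"
  by (simp add: symdiff_metric_eq_chordal symdiff_ratio_def)

lemma mean_variance_eq: "mean_variance = symdiff_ratio * mean_distance \<mu> (chordal \<theta>)"
proof -
  have "mean_distance \<mu> (symdiff_metric \<theta> \<mu> sin)
      = (LINT x|\<mu>. (LINT x'|\<mu>. symdiff_ratio * chordal \<theta> x x'))"
    unfolding mean_distance_def
    by (intro Bochner_Integration.integral_cong) (auto simp: symdiff_metric_eq space_mu)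
  then show ?thesis
    unfolding mean_symdiff_metric by (simp add: mean_distance_def)
qed

lemma chordal_measurable: "x \<in> Q \<Longrightarrow> chordal \<theta> x \<in> borel_measurable \<mu>"
  using const_measurable[of x \<mu>, measurable] unfolding chordal_def by measurable

lemma chordal_bound: "\<bar>chordal \<theta> x y\<bar> \<le> 1"
  by (simp add: chordal_def)

text \<open>Otherwise the chordal distance from any \<open>x\<close> would have mean zero and \<mu>
  would be concentrated at \<open>x\<close>; two distinct points make this impossible. This secures
  the denominator of \<open>gamma_const\<close>.\<close>

lemma mean_variance_nonzero: "mean_variance \<noteq> 0"
proof
  assume 0: "mean_variance = 0"
  have AE: "AE y in \<mu>. y = x" if "x \<in> Q" for x
  proof -
    have "(LINT y|\<mu>. symdiff_metric \<theta> \<mu> sin x y) = (LINT y|\<mu>. symdiff_ratio * chordal \<theta> x y)"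
      using that
      by (intro Bochner_Integration.integral_cong) (auto simp: symdiff_metric_eq space_mu)
    then have "(LINT y|\<mu>. chordal \<theta> x y) = 0"
      using 0 integral_symdiff_metric[OF that] symdiff_ratio_pos by simp
    moreover have "integrable \<mu> (chordal \<theta> x)"
      using chordal_bound chordal_measurable[OF that] by (intro bounded_integrable[where B = 1])
    moreover have "AE y in \<mu>. 0 \<le> chordal \<theta> x y"
      using that alpha_pos by (intro AE_I2) (simp add: chordal_eq space_mu)
    ultimately have "AE y in \<mu>. chordal \<theta> x y = 0"
      using integral_nonneg_eq_0_iff_AE by blast
    then show ?thesis
      using AE_space by eventually_elim (use that alpha_pos in \<open>auto simp: chordal_eq space_mu\<close>)
  qed
  obtain x y where xy: "x \<in> Q" "y \<in> Q" "x \<noteq> y"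
    using two_points by blast
  have "AE z in \<mu>. False"
    using AE[OF xy(1)] AE[OF xy(2)] by eventually_elim (use xy in auto)
  then show False by simp
qed

text \<open>The two means stand in the same ratio as the metrics themselves, and the nonzero mean of
  the chordal metric cancels.\<close>

lemma gamma_const_eq: "gamma_const \<theta> \<mu> = 1 / symdiff_ratio"
  using mean_variance_nonzero symdiff_ratio_pos
  by (simp add: gamma_const_def mean_symdiff_metric mean_variance_eq field_simps)

theorem stolarsky_invariance:
  assumes "D \<in> point_sets \<mu> N"
  shows "gamma_const \<theta> \<mu> * discrepancy \<theta> \<mu> sin D + distance_sum (chordal \<theta>) D
    = mean_distance \<mu> (chordal \<theta>) * (real N)\<^sup>2"
proof -
  obtain xs where xs: "D = mset xs"
    by (metis ex_mset)
  then have Q: "set xs \<subseteq> Q" and N: "length xs = N"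
    using assms by (auto simp: point_sets_def space_mu)
  have "distance_sum (symdiff_metric \<theta> \<mu> sin) D = symdiff_ratio * distance_sum (chordal \<theta>) D"
    unfolding xs distance_sum_mset sum_distrib_left using Q nth_mem
    by (intro sum.cong refl symdiff_metric_eq) auto
  then have "discrepancy \<theta> \<mu> sin D
      = symdiff_ratio * (mean_distance \<mu> (chordal \<theta>) * (real N)\<^sup>2 - distance_sum (chordal \<theta>) D)"
    using discrepancy_mset[OF Q] xs N by (simp add: mean_variance_eq algebra_simps)
  then show ?thesis
    using symdiff_ratio_pos by (simp add: gamma_const_eq)
qed

text \<open>The identity for a single \<open>D\<close> makes the discrepancy a decreasing affine
  function of the distance sum, so the infimum of the one corresponds to the supremum of the other.
  As these are taken in the reals, the family must be nonempty and the sums bounded; chordal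
  distances are at most 1, so \<open>N^2\<close> is a bound.\<close>

theorem stolarsky_invariance_extremal:
  "gamma_const \<theta> \<mu> * min_discrepancy \<theta> \<mu> sin N + max_distance_sum \<mu> (chordal \<theta>) N
    = mean_distance \<mu> (chordal \<theta>) * (real N)\<^sup>2"
proof -
  let ?P = "point_sets \<mu> N" and ?m = "mean_distance \<mu> (chordal \<theta>) * (real N)\<^sup>2"
    and ?S = "max_distance_sum \<mu> (chordal \<theta>) N"
  obtain x where "x \<in> Q" using two_points by blast
  then have ne: "?P \<noteq> {}"
    by (auto simp: point_sets_def space_mu intro!: exI[of _ "replicate_mset N x"] split: if_splits)
  have disc: "discrepancy \<theta> \<mu> sin D = symdiff_ratio * (?m - distance_sum (chordal \<theta>) D)"
    if "D \<in> ?P" for D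
    using stolarsky_invariance[OF that] symdiff_ratio_pos by (simp add: gamma_const_eq field_simps)
  have "distance_sum (chordal \<theta>) D \<le> real N * (real N * 1)" if D: "D \<in> ?P" for D
  proof -
    obtain xs where "D = mset xs" by (metis ex_mset)
    moreover from this have "length xs = N" using D by (simp add: point_sets_def)
    moreover have "(\<Sum>i<N. \<Sum>j<N. chordal \<theta> (xs ! i) (xs ! j)) \<le> (\<Sum>i<N. \<Sum>j<N. 1)"
      using chordal_bound abs_le_D1 by (intro sum_mono) blast
    ultimately show ?thesis
      by (simp add: distance_sum_mset)
  qed
  then have bdd: "bdd_above (distance_sum (chordal \<theta>) ` ?P)"
    by (intro bdd_aboveI2)
  have "min_discrepancy \<theta> \<mu> sin N = symdiff_ratio * (?m - ?S)"
    unfolding min_discrepancy_def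
  proof (rule cInf_eq_non_empty)
    show "discrepancy \<theta> \<mu> sin ` ?P \<noteq> {}" using ne by simp
    show "symdiff_ratio * (?m - ?S) \<le> d" if "d \<in> discrepancy \<theta> \<mu> sin ` ?P" for d
      using that symdiff_ratio_pos
      by (auto simp: disc max_distance_sum_def intro!: cSUP_upper bdd)
  next
    fix l assume l: "\<And>d. d \<in> discrepancy \<theta> \<mu> sin ` ?P \<Longrightarrow> l \<le> d"
    have "?S \<le> ?m - l / symdiff_ratio"
      unfolding max_distance_sum_def
    proof (rule cSUP_least[OF ne])
      fix D assume "D \<in> ?P"
      then have "l \<le> symdiff_ratio * (?m - distance_sum (chordal \<theta>) D)"
        using l disc by (metis imageI)
      then show "distance_sum (chordal \<theta>) D \<le> ?m - l / symdiff_ratio"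
        using symdiff_ratio_pos by (simp add: field_simps)
    qed
    then show "l \<le> symdiff_ratio * (?m - ?S)"
      using symdiff_ratio_pos by (simp add: field_simps)
  qed
  then show ?thesis
    using symdiff_ratio_pos by (simp add: gamma_const_eq)
qed

end


section \<open>Projective spaces\<close>

text \<open>For \<open>u \<noteq> w\<close> this is the Householder reflection in the hyperplane
  orthogonal to \<open>v = u - w\<close>. Equal norms give
  \<open>2 (v \<bullet> u) = v \<bullet> v\<close>, so \<open>u\<close> is moved to
  \<open>u - v = w\<close>.\<close>

lemma exists_reflection:
  fixes u w :: "'a::euclidean_space"
  assumes "norm u = norm w"
  shows "\<exists>h. orthogonal_transformation h \<and> h u = w \<and> (\<forall>z. z \<bullet> u = 0 \<and> z \<bullet> w = 0 \<longrightarrow> h z = z)"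
proof (cases "u = w")
  case True
  then show ?thesis
    by (intro exI[of _ "\<lambda>x. x"]) (auto simp: orthogonal_transformation linear_id[unfolded id_def])
next
  case False
  define v where "v = u - w"
  define h where "h z = z - (2 * (v \<bullet> z) / (v \<bullet> v)) *\<^sub>R v" for z
  have v: "v \<bullet> v \<noteq> 0" using False by (simp add: v_def)
  have uw: "u \<bullet> u = w \<bullet> w"
    using assms by (simp add: dot_square_norm)
  have "linear h"
    by (rule linearI) (simp_all add: h_def inner_add_right add_divide_distrib algebra_simps)
  moreover have "h x \<bullet> h y = x \<bullet> y" for x y
    using v by (simp add: h_def inner_diff inner_commute power2_eq_square)
  moreover have "h u = w"
  proof -
    have "2 * (v \<bullet> u) = v \<bullet> v"
      by (simp add: v_def uw inner_diff inner_commute)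
    then show ?thesis using v by (simp add: h_def) (simp add: v_def)
  qed
  moreover have "h z = z" if "z \<bullet> u = 0" "z \<bullet> w = 0" for z
    using that by (simp add: h_def v_def inner_diff inner_commute)
  ultimately show ?thesis
    by (auto simp: orthogonal_transformation_def)
qed

text \<open>Two reflections suffice: the second moves the image of \<open>y\<close> to
  \<open>b\<close> and fixes \<open>a\<close>, because \<open>a\<close> is orthogonal to
  both.\<close>

lemma exists_orthogonal_matrix_pair:
  fixes x y a b :: "real^'m"
  assumes "norm x = 1" "norm y = 1" "x \<bullet> y = 0" "norm a = 1" "norm b = 1" "a \<bullet> b = 0"
  shows "\<exists>g. orthogonal_matrix g \<and> g *v x = a \<and> g *v y = b"
proof -
  obtain h where h: "orthogonal_transformation h" "h x = a"
    using exists_reflection[of x a] assms by auto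
  have "norm (h y) = norm b"
    using h assms by (simp add: orthogonal_transformation_norm)
  then obtain h' where h': "orthogonal_transformation h'" "h' (h y) = b"
      "\<And>z. z \<bullet> h y = 0 \<Longrightarrow> z \<bullet> b = 0 \<Longrightarrow> h' z = z"
    using exists_reflection by metis
  have "a \<bullet> h y = 0"
    using h assms by (metis orthogonal_transformation_def)
  then have "h' a = a"
    using h' assms by auto
  moreover have "orthogonal_transformation (h' \<circ> h)"
    using h h' by (auto intro: orthogonal_transformation_compose)
  ultimately show ?thesis
    using h h' matrix_works[of "h' \<circ> h"]
    by (intro exI[of _ "matrix (h' \<circ> h)"])
      (auto simp: orthogonal_transformation_matrix orthogonal_transformation_linear)
qed

lemma exists_orthogonal_matrix:
  fixes x a :: "real^'m"
  assumes "norm x = 1" "norm a = 1"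
  shows "\<exists>g. orthogonal_matrix g \<and> g *v x = a"
proof -
  obtain h where "orthogonal_transformation h" "h x = a"
    using exists_reflection[of x a] assms by auto
  then show ?thesis
    using matrix_works[of h] by (intro exI[of _ "matrix h"])
      (auto simp: orthogonal_transformation_matrix orthogonal_transformation_linear)
qed

lemma norm_matrix_cong:
  fixes P R :: "('f::euclidean_space)^'m^'m"
  assumes "\<And>i j. norm (P $ i $ j) = norm (R $ i $ j)" shows "norm P = norm R"
  using assms by (simp add: norm_vec_def L2_set_def)

section \<open>Conjugation by real orthogonal matrices\<close>

definition row_mix :: "real^'m^'m \<Rightarrow> ('f::euclidean_space)^'m^'m \<Rightarrow> 'f^'m^'m" where
  "row_mix g P = (\<chi> i j. \<Sum>k\<in>UNIV. g $ i $ k *\<^sub>R P $ k $ j)"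

definition col_mix :: "real^'m^'m \<Rightarrow> ('f::euclidean_space)^'m^'m \<Rightarrow> 'f^'m^'m" where
  "col_mix g P = (\<chi> i j. \<Sum>k\<in>UNIV. g $ j $ k *\<^sub>R P $ i $ k)"

text \<open>This is \<open>g P g^T\<close>: \<open>row_mix\<close> multiplies by \<open>g\<close>
  from the left, \<open>col_mix\<close> by its transpose from the right. Real scalars commute and
  associate with all elements, so the bracketing is harmless even over the octonions.\<close>

definition real_conjugation :: "real^'m^'m \<Rightarrow> ('f::euclidean_space)^'m^'m \<Rightarrow> 'f^'m^'m" where
  "real_conjugation g P = row_mix g (col_mix g P)"

lemma orthogonal_matrix_sum:
  assumes "orthogonal_matrix (g :: real^'m^'m)"
  shows "(\<Sum>i\<in>UNIV. g $ i $ k * g $ i $ l) = (if k = l then 1 else 0)"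
proof -
  have "(transpose g ** g) $ k $ l = mat 1 $ k $ l"
    using assms by (simp add: orthogonal_matrix_def)
  then show ?thesis
    by (simp add: matrix_matrix_mult_def transpose_def mat_def)
qed

text \<open>The relation \<open>g^T g = 1\<close> summed against an arbitrary array. It is applied
  to matrix entries for the trace, to inner products for the norm and to products of entries for
  matrix multiplication.\<close>

lemma orthogonal_sum_collapse:
  fixes P :: "'m::finite \<Rightarrow> 'm \<Rightarrow> 'v::real_vector"
  assumes "orthogonal_matrix (g :: real^'m^'m)"
  shows "(\<Sum>i\<in>UNIV. \<Sum>k\<in>UNIV. \<Sum>l\<in>UNIV. (g $ i $ k * g $ i $ l) *\<^sub>R P k l) = (\<Sum>k\<in>UNIV. P k k)"
proof -
  have "(\<Sum>i\<in>UNIV. \<Sum>k\<in>UNIV. \<Sum>l\<in>UNIV. (g $ i $ k * g $ i $ l) *\<^sub>R P k l)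
      = (\<Sum>k\<in>UNIV. \<Sum>i\<in>UNIV. \<Sum>l\<in>UNIV. (g $ i $ k * g $ i $ l) *\<^sub>R P k l)"
    by (rule sum.swap)
  also have "\<dots> = (\<Sum>k\<in>UNIV. \<Sum>l\<in>UNIV. \<Sum>i\<in>UNIV. (g $ i $ k * g $ i $ l) *\<^sub>R P k l)"
    by (intro sum.cong refl sum.swap)
  also have "\<dots> = (\<Sum>k\<in>UNIV. \<Sum>l\<in>UNIV. (if k = l then P k l else 0))"
    by (intro sum.cong refl) (simp add: orthogonal_matrix_sum[OF assms] flip: scaleR_sum_left)
  finally show ?thesis by simp
qed

lemma linear_row_mix: "linear (row_mix g)"
  by (rule linearI)
    (simp_all add: row_mix_def vec_eq_iff scaleR_right_distrib sum.distrib scaleR_sum_right mult.commute)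

lemma linear_col_mix: "linear (col_mix g)"
  by (rule linearI)
    (simp_all add: col_mix_def vec_eq_iff scaleR_right_distrib sum.distrib scaleR_sum_right mult.commute)

lemma linear_real_conjugation: "linear (real_conjugation g)"
  using linear_compose[OF linear_col_mix linear_row_mix]
  by (simp add: real_conjugation_def[abs_def] comp_def)

lemma row_col_mix_commute: "row_mix g (col_mix h P) = col_mix h (row_mix g P)"
proof -
  have "(\<Sum>k\<in>UNIV. g $ i $ k *\<^sub>R (\<Sum>l\<in>UNIV. h $ j $ l *\<^sub>R P $ k $ l))
      = (\<Sum>l\<in>UNIV. h $ j $ l *\<^sub>R (\<Sum>k\<in>UNIV. g $ i $ k *\<^sub>R P $ k $ l))" for i j
    unfolding scaleR_sum_right by (subst sum.swap) (simp add: mult.commute)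
  then show ?thesis
    by (simp add: row_mix_def col_mix_def)
qed

lemma row_mix_inverse:
  assumes "orthogonal_matrix g" shows "row_mix g (row_mix (transpose g) P) = P"
proof -
  have g: "g ** transpose g = mat 1"
    using assms by (simp add: orthogonal_matrix_def)
  have "(\<Sum>k\<in>UNIV. g $ i $ k * g $ l $ k) = (if i = l then 1 else 0)" for i l
    using arg_cong[OF g, of "\<lambda>A. A $ i $ l"]
    by (simp add: matrix_matrix_mult_def transpose_def mat_def)
  note * = this
  have "(\<Sum>k\<in>UNIV. g $ i $ k *\<^sub>R (\<Sum>l\<in>UNIV. g $ l $ k *\<^sub>R P $ l $ j)) = P $ i $ j" for i j
  proof -
    have "(\<Sum>k\<in>UNIV. g $ i $ k *\<^sub>R (\<Sum>l\<in>UNIV. g $ l $ k *\<^sub>R P $ l $ j))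
        = (\<Sum>l\<in>UNIV. \<Sum>k\<in>UNIV. (g $ i $ k * g $ l $ k) *\<^sub>R P $ l $ j)"
      unfolding scaleR_sum_right by (subst sum.swap) simp
    also have "\<dots> = (\<Sum>l\<in>UNIV. if i = l then P $ l $ j else 0)"
      by (intro sum.cong refl) (simp add: * flip: scaleR_sum_left)
    finally show ?thesis by simp
  qed
  then show ?thesis
    by (simp add: row_mix_def transpose_def vec_eq_iff)
qed

lemma col_mix_eq_transpose: "col_mix g P = transpose (row_mix g (transpose P))"
  by (simp add: row_mix_def col_mix_def transpose_def)

lemma col_mix_inverse: "orthogonal_matrix g \<Longrightarrow> col_mix g (col_mix (transpose g) P) = P"
  by (simp add: col_mix_eq_transpose transpose_transpose row_mix_inverse)

lemma real_conjugation_inverse: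
  assumes "orthogonal_matrix g"
  shows "real_conjugation g (real_conjugation (transpose g) P) = P"
  using assms by (simp add: real_conjugation_def row_col_mix_commute[of "transpose g"] col_mix_inverse)
    (simp add: row_mix_inverse)

lemma norm_row_mix:
  assumes "orthogonal_matrix g" shows "norm (row_mix g P) = norm P"
proof -
  have "row_mix g P \<bullet> row_mix g P
      = (\<Sum>i\<in>UNIV. \<Sum>j\<in>UNIV. \<Sum>k\<in>UNIV. \<Sum>l\<in>UNIV. (g $ i $ k * g $ i $ l) *\<^sub>R (P $ l $ j \<bullet> P $ k $ j))"
    by (simp add: inner_vec_def row_mix_def inner_sum_left inner_sum_right sum_distrib_left mult.assoc)
  also have "\<dots> = (\<Sum>j\<in>UNIV. \<Sum>i\<in>UNIV. \<Sum>k\<in>UNIV. \<Sum>l\<in>UNIV. (g $ i $ k * g $ i $ l) *\<^sub>R (P $ l $ j \<bullet> P $ k $ j))"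
    by (rule sum.swap)
  also have "\<dots> = (\<Sum>j\<in>UNIV. \<Sum>k\<in>UNIV. P $ k $ j \<bullet> P $ k $ j)"
    by (simp only: orthogonal_sum_collapse[OF assms])
  also have "\<dots> = P \<bullet> P"
    unfolding inner_vec_def by (rule sum.swap)
  finally show ?thesis by (simp add: norm_eq_sqrt_inner)
qed

lemma norm_transpose: "norm (transpose P) = norm (P :: ('f::euclidean_space)^'m^'m)"
proof -
  have "transpose P \<bullet> transpose P = P \<bullet> P"
    unfolding inner_vec_def transpose_def vec_lambda_beta by (rule sum.swap)
  then show ?thesis by (simp add: norm_eq_sqrt_inner)
qed

lemma norm_real_conjugation: "orthogonal_matrix g \<Longrightarrow> norm (real_conjugation g P) = norm P"
  by (simp add: real_conjugation_def norm_row_mix col_mix_eq_transpose norm_transpose)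

context composition_algebra
begin

definition mat_mul :: "'f^'m::finite^'m \<Rightarrow> 'f^'m^'m \<Rightarrow> 'f^'m^'m" where
  "mat_mul P R = (\<chi> i j. \<Sum>k\<in>UNIV. P $ i $ k \<odot> R $ k $ j)"

lemma proj_space_iff:
  "P \<in> proj_space (\<odot>) cj e \<longleftrightarrow>
    (\<forall>i j. P $ j $ i = cj (P $ i $ j)) \<and> mat_mul P P = P \<and> (\<Sum>i\<in>UNIV. P $ i $ i) = e"
  by (auto simp: proj_space_def mat_mul_def vec_eq_iff)

lemma mat_mul_row_mix: "mat_mul (row_mix g P) R = row_mix g (mat_mul P R)"
proof -
  have "(\<Sum>k\<in>UNIV. (\<Sum>l\<in>UNIV. g $ i $ l *\<^sub>R P $ l $ k) \<odot> R $ k $ j)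
      = (\<Sum>l\<in>UNIV. g $ i $ l *\<^sub>R (\<Sum>k\<in>UNIV. P $ l $ k \<odot> R $ k $ j))" for i j
    unfolding scaleR_sum_right mul_sum_left mul_simps by (rule sum.swap)
  then show ?thesis
    by (simp add: mat_mul_def row_mix_def)
qed

lemma mat_mul_col_mix: "mat_mul P (col_mix g R) = col_mix g (mat_mul P R)"
proof -
  have "(\<Sum>k\<in>UNIV. P $ i $ k \<odot> (\<Sum>l\<in>UNIV. g $ j $ l *\<^sub>R R $ k $ l))
      = (\<Sum>l\<in>UNIV. g $ j $ l *\<^sub>R (\<Sum>k\<in>UNIV. P $ i $ k \<odot> R $ k $ l))" for i j
    unfolding scaleR_sum_right mul_sum_right mul_simps by (rule sum.swap)
  then show ?thesis
    by (simp add: mat_mul_def col_mix_def)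
qed

lemma mat_mul_col_row_mix:
  assumes "orthogonal_matrix g" shows "mat_mul (col_mix g P) (row_mix g R) = mat_mul P R"
proof -
  have "(\<Sum>k\<in>UNIV. (\<Sum>l\<in>UNIV. g $ k $ l *\<^sub>R P $ i $ l) \<odot> (\<Sum>l\<in>UNIV. g $ k $ l *\<^sub>R R $ l $ j))
      = (\<Sum>k\<in>UNIV. \<Sum>l\<in>UNIV. \<Sum>l'\<in>UNIV. (g $ k $ l * g $ k $ l') *\<^sub>R (P $ i $ l \<odot> R $ l' $ j))" for i j
    unfolding mul_sum_left unfolding mul_sum_right by (simp add: mul_simps mult.commute)
  then show ?thesis
    by (simp add: mat_mul_def row_mix_def col_mix_def orthogonal_sum_collapse[OF assms])
qed

lemma real_conjugation_in_proj_space: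
  assumes g: "orthogonal_matrix g" and P: "P \<in> proj_space (\<odot>) cj e"
  shows "real_conjugation g P \<in> proj_space (\<odot>) cj e"
proof -
  from P have herm: "P $ j $ i = cj (P $ i $ j)" and idem: "mat_mul P P = P"
    and trace: "(\<Sum>i\<in>UNIV. P $ i $ i) = e" for i j
    unfolding proj_space_iff by blast+
  \<comment> \<open>Mixing rows commutes with mixing columns, so the second factor may be written
    with its column mixing outside. The outer operations then leave the product and the inner ones
    cancel.\<close>
  have "mat_mul (real_conjugation g P) (real_conjugation g P)
      = mat_mul (row_mix g (col_mix g P)) (col_mix g (row_mix g P))"
    by (simp only: real_conjugation_def row_col_mix_commute[of g g P, symmetric])
  also have "\<dots> = real_conjugation g (mat_mul P P)"
    by (simp only: mat_mul_row_mix mat_mul_col_mix mat_mul_col_row_mix[OF g] real_conjugation_def)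
      (rule row_col_mix_commute[symmetric])
  finally have 1: "mat_mul (real_conjugation g P) (real_conjugation g P) = real_conjugation g P"
    by (simp add: idem)
  have "(\<Sum>i\<in>UNIV. real_conjugation g P $ i $ i)
      = (\<Sum>i\<in>UNIV. \<Sum>k\<in>UNIV. \<Sum>l\<in>UNIV. (g $ i $ k * g $ i $ l) *\<^sub>R P $ k $ l)"
    by (simp add: real_conjugation_def row_mix_def col_mix_def scaleR_sum_right)
  then have 2: "(\<Sum>i\<in>UNIV. real_conjugation g P $ i $ i) = e"
    by (simp add: orthogonal_sum_collapse[OF g] trace)
  have "real_conjugation g P $ j $ i = cj (real_conjugation g P $ i $ j)" for i j
  proof -
    have "cj (real_conjugation g P $ i $ j) = (\<Sum>k\<in>UNIV. \<Sum>l\<in>UNIV. (g $ i $ k * g $ j $ l) *\<^sub>R cj (P $ k $ l))"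
      by (simp add: real_conjugation_def row_mix_def col_mix_def scaleR_sum_right)
    also have "\<dots> = (\<Sum>k\<in>UNIV. \<Sum>l\<in>UNIV. (g $ i $ k * g $ j $ l) *\<^sub>R P $ l $ k)"
      by (simp only: herm[symmetric])
    also have "\<dots> = real_conjugation g P $ j $ i"
      by (subst sum.swap) (simp add: real_conjugation_def row_mix_def col_mix_def scaleR_sum_right mult.commute)
    finally show ?thesis by simp
  qed
  with 1 2 show ?thesis unfolding proj_space_iff by blast
qed

lemma real_conjugation_isometry:
  assumes "orthogonal_matrix g"
  shows "real_conjugation g \<in> linear_isometries (proj_space (\<odot>) cj e)"
proof (rule linear_isometriesI)
  have "orthogonal_matrix (transpose g)"
    using assms by (simp add: orthogonal_matrix_transpose)
  then show "real_conjugation (transpose g) P \<in> proj_space (\<odot>) cj e"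
    if "P \<in> proj_space (\<odot>) cj e" for P
    using that by (rule real_conjugation_in_proj_space)
qed (use assms in \<open>simp_all add: linear_real_conjugation norm_real_conjugation
      real_conjugation_in_proj_space real_conjugation_inverse\<close>)

definition outer :: "real^'m \<Rightarrow> real^'m \<Rightarrow> 'f^'m^'m" where
  "outer p q = (\<chi> i j. (p $ i * q $ j) *\<^sub>R e)"

lemma outer_simps:
  "outer (p + q) r = outer p r + outer q r" "outer p (q + r) = outer p q + outer p r"
  "outer (p - q) r = outer p r - outer q r" "outer p (q - r) = outer p q - outer p r"
  "outer (c *\<^sub>R p) r = c *\<^sub>R outer p r" "outer p (c *\<^sub>R r) = c *\<^sub>R outer p r"
  by (auto simp: outer_def vec_eq_iff algebra_simps)

lemma inner_outer: "outer p q \<bullet> outer p' q' = (p \<bullet> p') * (q \<bullet> q')"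
  by (simp add: inner_vec_def outer_def sum_product mult_ac)

lemma real_conjugation_outer: "real_conjugation g (outer p q) = outer (g *v p) (g *v q)"
  by (simp add: real_conjugation_def row_mix_def col_mix_def outer_def vec_eq_iff
      matrix_vector_mult_def sum_product scaleR_sum_right mult_ac flip: scaleR_sum_left)
    (simp add: sum_distrib_left mult_ac)

lemma outer_in_proj_space:
  assumes "norm p = 1" shows "outer p p \<in> proj_space (\<odot>) cj e"
proof -
  have "(\<Sum>i\<in>UNIV. p $ i * p $ i) = 1"
    using assms by (simp add: norm_eq_1 inner_vec_def)
  moreover have "(\<Sum>k\<in>UNIV. (p $ i * p $ k) *\<^sub>R e \<odot> (p $ k * p $ j) *\<^sub>R e)
      = (p $ i * p $ j * (\<Sum>k\<in>UNIV. p $ k * p $ k)) *\<^sub>R e" for i j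
    by (simp add: mul_simps sum_distrib_left mult_ac flip: scaleR_sum_left)
  ultimately show ?thesis
    by (simp add: proj_space_def outer_def mult.commute flip: scaleR_sum_left)
qed

section \<open>Entries of a projection matrix\<close>

context
  fixes P :: "'f^'m::finite^'m"
  assumes P: "P \<in> proj_space (\<odot>) cj e"
begin

lemma proj_hermitian: "P $ j $ i = cj (P $ i $ j)"
  and proj_idempotent: "(\<Sum>k\<in>UNIV. P $ i $ k \<odot> P $ k $ j) = P $ i $ j"
  and proj_trace: "(\<Sum>i\<in>UNIV. P $ i $ i) = e"
  using P unfolding proj_space_def by blast+

text \<open>By idempotence and Hermitian symmetry the entry is a sum of products of the form
  \<open>x \<odot> cj x\<close>, each a real multiple of \<open>e\<close>.\<close>

lemma proj_diagonal: "P $ i $ i = (\<Sum>j\<in>UNIV. P $ i $ j \<bullet> P $ i $ j) *\<^sub>R e"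
proof -
  have "P $ i $ i = (\<Sum>j\<in>UNIV. P $ i $ j \<odot> P $ j $ i)"
    by (simp add: proj_idempotent)
  also have "\<dots> = (\<Sum>j\<in>UNIV. (P $ i $ j \<bullet> P $ i $ j) *\<^sub>R e)"
    by (intro sum.cong refl) (metis mul_cj_self proj_hermitian)
  finally show ?thesis by (simp add: scaleR_sum_left)
qed

text \<open>By \<open>proj_diagonal\<close> the trace is the squared Frobenius norm times
  \<open>e\<close>.\<close>

lemma norm_proj: "norm P = 1"
proof -
  have "(P \<bullet> P) *\<^sub>R e = e"
    using proj_trace unfolding inner_vec_def scaleR_sum_left
    by (subst (asm) proj_diagonal) (simp add: scaleR_sum_left)
  then have "((P \<bullet> P) *\<^sub>R e) \<bullet> e = 1" by simp
  then show ?thesis by (simp add: norm_eq_1)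
qed

text \<open>This replaces the factorization of a rank-one matrix. The defect \<open>N\<close>
  vanishes because its norm does: \<open>P\<close> has squared norm 1, the array of products has
  squared norm \<open>\<alpha>^2\<close>, their inner product is \<alpha>, and so
  \<open>N \<bullet> N = \<alpha>^2 - 2 \<alpha>^2 + \<alpha>^2\<close>.\<close>

lemma proj_rank_one:
  assumes k: "P $ k $ k = \<alpha> *\<^sub>R e" shows "P $ i $ k \<odot> P $ k $ j = \<alpha> *\<^sub>R P $ i $ j"
proof -
  have row: "(\<Sum>j\<in>UNIV. P $ k $ j \<bullet> P $ k $ j) = \<alpha>"
  proof -
    have "((\<Sum>j\<in>UNIV. P $ k $ j \<bullet> P $ k $ j) *\<^sub>R e) \<bullet> e = (\<alpha> *\<^sub>R e) \<bullet> e"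
      using proj_diagonal[of k] k by simp
    then show ?thesis by simp
  qed
  have col: "(\<Sum>i\<in>UNIV. P $ i $ k \<bullet> P $ i $ k) = \<alpha>"
    by (subst row[symmetric], intro sum.cong refl) (metis inner_cj proj_hermitian)
  define N where "N = (\<chi> i j. \<alpha> *\<^sub>R P $ i $ j - P $ i $ k \<odot> P $ k $ j)"
  have "(\<Sum>j\<in>UNIV. P $ i $ j \<bullet> (P $ i $ k \<odot> P $ k $ j)) = P $ i $ k \<bullet> P $ i $ k" for i
  proof -
    \<comment> \<open>An adjoint moves \<open>P $ k $ j\<close> to the other side as
      \<open>P $ j $ k\<close>; the sum over \<open>j\<close> is then evaluated by
      idempotence.\<close>
    have "P $ i $ j \<bullet> (P $ i $ k \<odot> P $ k $ j) = (P $ i $ j \<odot> P $ j $ k) \<bullet> P $ i $ k" for j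
      by (metis inner_commute inner_mul_adjoint_right proj_hermitian)
    then show ?thesis
      using proj_idempotent[of i k] by (simp flip: inner_sum_left)
  qed
  then have cross: "(\<Sum>i\<in>UNIV. \<Sum>j\<in>UNIV. P $ i $ j \<bullet> (P $ i $ k \<odot> P $ k $ j)) = \<alpha>"
    by (simp add: col)
  have sq: "(\<Sum>i\<in>UNIV. \<Sum>j\<in>UNIV. (P $ i $ k \<odot> P $ k $ j) \<bullet> (P $ i $ k \<odot> P $ k $ j)) = \<alpha> * \<alpha>"
    by (simp add: inner_mul_self row col flip: sum_product)
  have "(\<alpha> *\<^sub>R P $ i $ j - P $ i $ k \<odot> P $ k $ j) \<bullet> (\<alpha> *\<^sub>R P $ i $ j - P $ i $ k \<odot> P $ k $ j)
      = \<alpha>\<^sup>2 * (P $ i $ j \<bullet> P $ i $ j) - 2 * \<alpha> * (P $ i $ j \<bullet> (P $ i $ k \<odot> P $ k $ j))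
        + (P $ i $ k \<odot> P $ k $ j) \<bullet> (P $ i $ k \<odot> P $ k $ j)" for i j
    by (simp add: inner_diff inner_commute power2_eq_square)
  then have "N \<bullet> N = \<alpha>\<^sup>2 * (P \<bullet> P) - 2 * \<alpha> * \<alpha> + \<alpha> * \<alpha>"
    unfolding N_def
    by (simp add: inner_vec_def[of "vec_lambda _"] sum.distrib sum_subtractf cross sq flip: sum_distrib_left)
       (simp add: inner_vec_def)
  also have "\<dots> = 0"
    using norm_proj by (simp add: norm_eq_1 power2_eq_square)
  finally have "N $ i $ j = 0" by simp
  then show ?thesis by (simp add: N_def)
qed

lemma proj_diagonal_nonzero: "\<exists>k. P $ k $ k \<noteq> 0"
proof (rule ccontr)
  assume "\<nexists>k. P $ k $ k \<noteq> 0"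
  then have "e = 0" using proj_trace by simp
  then show False using norm_unit by simp
qed

text \<open>By \<open>proj_rank_one\<close> a column with nonzero diagonal entry determines the
  matrix: \<open>x k *\<^sub>R P $ i $ j\<close> is \<open>x i * x j\<close> times \<open>e\<close>.
  Hence the scaling of \<open>p\<close> by \<open>sqrt (x k)\<close>, where \<open>x k\<close> is
  positive as a sum of squares; the trace gives the norm of \<open>p\<close>.\<close>

lemma real_column_imp_outer:
  assumes k: "P $ k $ k \<noteq> 0" and real: "\<And>i. P $ i $ k = x i *\<^sub>R e"
  shows "\<exists>p. norm p = 1 \<and> P = outer p p"
proof -
  have \<alpha>: "0 < x k"
  proof -
    have "x k = (\<Sum>j\<in>UNIV. P $ k $ j \<bullet> P $ k $ j)"
      using arg_cong[OF proj_diagonal[of k], of "\<lambda>y. y \<bullet> e"] real by simp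
    also have "\<dots> \<ge> 0" by (intro sum_nonneg) simp
    finally show ?thesis using k real[of k] by (cases "x k = 0") auto
  qed
  define p :: "real^'m" where "p = (\<chi> i. x i / sqrt (x k))"
  have eq: "P = outer p p"
  proof -
    have "P $ i $ j = (p $ i * p $ j) *\<^sub>R e" for i j
    proof -
      have "P $ k $ j = x j *\<^sub>R e"
        using proj_hermitian[of k j] real[of j] by simp
      then have "x k *\<^sub>R P $ i $ j = (x i * x j) *\<^sub>R e"
        using proj_rank_one[OF real[of k], of i j] real[of i] by (simp add: mul_simps mult.commute)
      then have "(1 / x k) *\<^sub>R (x k *\<^sub>R P $ i $ j) = (1 / x k) *\<^sub>R ((x i * x j) *\<^sub>R e)"
        by (rule arg_cong)
      then show ?thesis using \<alpha> by (simp add: p_def)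
    qed
    then show ?thesis by (simp add: outer_def vec_eq_iff)
  qed
  have "(p \<bullet> p) *\<^sub>R e = e"
    using proj_trace by (subst (asm) eq) (simp add: outer_def inner_vec_def scaleR_sum_left)
  then have "((p \<bullet> p) *\<^sub>R e) \<bullet> e = e \<bullet> e" by simp
  with eq show ?thesis
    by (intro exI[of _ p]) (simp add: norm_eq_1)
qed

end

text \<open>The hypothesis \<open>realify\<close> asks that the map also fix every coordinate
  projection. This is what makes two points real together: once one of them has been moved to a
  coordinate projection, it stays there while the other is made real.\<close>

lemma proj_spherical_embedding:
  assumes realify: "\<And>P. P \<in> proj_space (\<odot>) cj e \<Longrightarrow>
      \<exists>T\<in>linear_isometries (proj_space (\<odot>) cj e). \<exists>p. norm p = 1 \<and> T P = outer p p \<and>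
        (\<forall>a::'m::finite. T (outer (axis a 1) (axis a 1)) = outer (axis a 1) (axis a 1))"
    and card: "CARD('m) \<ge> 2"
  shows "\<exists>A. spherical_embedding (proj_space (\<odot>) cj e :: ('f^'m^'m) set) proj_theta 2 A"
proof -
  let ?Q = "proj_space (\<odot>) cj e :: ('f^'m^'m) set"
  obtain a b :: 'm where ab: "a \<noteq> b"
    using card by (metis (full_types) UNIV_I card_2_iff' card_le_Suc0_iff_eq finite numeral_2_eq_2 not_less_eq_eq)
  define E where "E = (\<lambda>a::'m. outer (axis a 1) (axis a 1))"
  have to_axis: "\<exists>T\<in>linear_isometries ?Q. T P = E a" if P: "P \<in> ?Q" for P
  proof -
    obtain T p where T: "T \<in> linear_isometries ?Q" "norm p = 1" "T P = outer p p"
      using realify[OF P] by blast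
    obtain g where g: "orthogonal_matrix g" "g *v p = axis a 1"
      using exists_orthogonal_matrix[of p "axis a 1"] T(2) by (auto simp: norm_axis_1)
    have "real_conjugation g \<circ> T \<in> linear_isometries ?Q"
      by (intro linear_isometries_comp real_conjugation_isometry g T)
    then show ?thesis
      by (rule bexI[rotated]) (simp add: T g E_def real_conjugation_outer)
  qed
  have pair: "\<exists>T\<in>linear_isometries ?Q. \<exists>p r. norm p = 1 \<and> norm r = 1 \<and> T P = outer p p \<and> T R = outer r r"
    if PR: "P \<in> ?Q" "R \<in> ?Q" for P R
  proof -
    obtain S where S: "S \<in> linear_isometries ?Q" "S R = E a"
      using to_axis[OF PR(2)] by blast
    obtain T p where T: "T \<in> linear_isometries ?Q" "norm p = 1" "T (S P) = outer p p" "T (E a) = E a"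
      using realify[OF linear_isometries_mem[OF S(1) PR(1)]] unfolding E_def by blast
    show ?thesis
      by (rule bexI[OF _ linear_isometries_comp[OF T(1) S(1)]], rule exI[of _ p], rule exI[of _ "axis a 1"])
        (use S T in \<open>simp add: norm_axis_1 E_def\<close>)
  qed
  \<comment> \<open>When both points are real, the inner product is the square of
    \<open>p \<bullet> r\<close>. Nonnegativity keeps the argument of \<open>arcsin\<close> at most
    1.\<close>
  have inner_nonneg: "0 \<le> P \<bullet> R" if PR: "P \<in> ?Q" "R \<in> ?Q" for P R
  proof -
    obtain T p r where T: "T \<in> linear_isometries ?Q" "T P = outer p p" "T R = outer r r"
      using pair[OF PR] by blast
    have "P \<bullet> R = T P \<bullet> T R"
      by (rule linear_isometries_inner[OF T(1), symmetric])
    then show ?thesis by (simp add: T inner_outer)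
  qed
  have dist: "(norm (P - R))\<^sup>2 = 2 * (1 - P \<bullet> R)" if PR: "P \<in> ?Q" "R \<in> ?Q" for P R
    using norm_proj[OF PR(1)] norm_proj[OF PR(2)]
    by (simp add: power2_norm_eq_inner inner_diff norm_eq_1 inner_commute)
  have small: "0 \<le> norm (P - R) / sqrt 2 \<and> norm (P - R) / sqrt 2 \<le> 1" if PR: "P \<in> ?Q" "R \<in> ?Q" for P R
  proof -
    have "norm (P - R) \<le> sqrt 2"
      using dist[OF PR] inner_nonneg[OF PR] by (intro real_le_rsqrt) simp
    then show ?thesis by simp
  qed
  \<comment> \<open>The common direction of all differences: \<open>x y^T + y x^T\<close> with the
    orthonormal vectors \<open>x\<close> and \<open>y\<close> placed on two coordinate axes.\<close>
  define A0 where "A0 = outer (axis a 1) (axis b 1) + outer (axis b 1) (axis a 1 :: real^'m)"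
  have A0: "norm A0 \<noteq> 0"
  proof
    assume "norm A0 = 0"
    then have "outer (axis a 1) (axis b 1) \<bullet> A0 = 0" by simp
    then show False using ab by (simp add: A0_def inner_add_right inner_outer inner_axis_axis)
  qed
  have "spherical_embedding ?Q proj_theta 2 (A0 /\<^sub>R norm A0)"
  proof
    show "norm P = 1" if "P \<in> ?Q" for P
      by (rule norm_proj[OF that])
    show "(0::real) < 2" by simp
    fix P R assume PR: "P \<in> ?Q" "R \<in> ?Q"
    note s = small[OF PR]
    have "0 \<le> arcsin (norm (P - R) / sqrt 2)"
      using s arcsin_le_arcsin[of 0 "norm (P - R) / sqrt 2"] by simp
    moreover have "arcsin (norm (P - R) / sqrt 2) \<le> pi / 2"
      using s arcsin_bounded[of "norm (P - R) / sqrt 2"] by linarith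
    ultimately show "0 \<le> proj_theta P R \<and> proj_theta P R \<le> pi"
      by (simp add: proj_theta_def)
    have "cos (proj_theta P R) = 1 - 2 * (sin (arcsin (norm (P - R) / sqrt 2)))\<^sup>2"
      unfolding proj_theta_def by (rule cos_double_sin)
    also have "sin (arcsin (norm (P - R) / sqrt 2)) = norm (P - R) / sqrt 2"
      using s by (intro sin_arcsin) linarith+
    also have "1 - 2 * (norm (P - R) / sqrt 2)\<^sup>2 = 1 - (norm (P - R))\<^sup>2"
      by (simp add: power_divide)
    finally show "cos (proj_theta P R) = 1 - 2 * (1 - P \<bullet> R)"
      using dist[OF PR] by simp
    obtain S T where S: "S \<in> linear_isometries ?Q" "S P = E a" and T: "T \<in> linear_isometries ?Q" "T R = E a"
      using to_axis PR by metis
    have "inv T (S P) = R"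
      using S T orthogonal_transformation_inj[of T] by (simp add: linear_isometries_def inv_f_eq)
    then show "\<exists>T\<in>linear_isometries ?Q. T P = R"
      using linear_isometries_comp[OF linear_isometries_inv[OF T(1)] S(1)] by (intro bexI) auto
    show "\<exists>T\<in>linear_isometries ?Q. T (P - R) = norm (P - R) *\<^sub>R (A0 /\<^sub>R norm A0)"
    proof (cases "P = R")
      case True
      then show ?thesis using id_linear_isometries by force
    next
      case False
      obtain T p r where T: "T \<in> linear_isometries ?Q" "norm p = 1" "norm r = 1" "T P = outer p p" "T R = outer r r"
        using pair[OF PR] by blast
      define x y where "x = p + r" and "y = p - r"
      have TPR: "T (P - R) = (1/2) *\<^sub>R (outer x y + outer y x)"
      proof -
        have "outer x y + outer y x = 2 *\<^sub>R (outer p p - outer r r)"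
          by (simp add: x_def y_def outer_simps scaleR_2)
        then show ?thesis
          using linear_diff[OF linear_isometries_linear[OF T(1)]] T(4,5) by simp
      qed
      have "T (P - R) \<noteq> 0"
        using False linear_isometries_norm[OF T(1), of "P - R"] by auto
      moreover have "outer 0 q = 0" "outer q 0 = 0" for q :: "real^'m"
        using outer_simps(5)[of 0 q q] outer_simps(6)[of q 0 q] by simp_all
      ultimately have xy: "x \<noteq> 0" "y \<noteq> 0"
        unfolding TPR by auto
      define c where "c = norm x * norm y / 2"
      have "x \<bullet> y = 0"
        using T by (simp add: x_def y_def inner_add inner_diff inner_commute norm_eq_1)
      then obtain g where g: "orthogonal_matrix g" "g *v (x /\<^sub>R norm x) = axis a 1" "g *v (y /\<^sub>R norm y) = axis b 1"
        using exists_orthogonal_matrix_pair[of "x /\<^sub>R norm x" "y /\<^sub>R norm y" "axis a 1" "axis b 1"] xy ab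
        by (auto simp: norm_axis_1 inner_axis_axis)
      have "T (P - R) = c *\<^sub>R (outer (x /\<^sub>R norm x) (y /\<^sub>R norm y) + outer (y /\<^sub>R norm y) (x /\<^sub>R norm x))"
        unfolding TPR c_def using xy by (simp add: outer_simps scaleR_add_right field_simps)
      then have gT: "real_conjugation g (T (P - R)) = c *\<^sub>R A0"
        by (simp only: linear_cmul[OF linear_real_conjugation] linear_add[OF linear_real_conjugation]
            real_conjugation_outer g A0_def)
      \<comment> \<open>All maps preserve norms, so the nonnegative factor \<open>c\<close> is the
        length of \<open>P - R\<close> divided by that of \<open>A0\<close>.\<close>
      have "norm (real_conjugation g (T (P - R))) = norm (P - R)"
        using g T by (simp add: norm_real_conjugation linear_isometries_norm)
      then have "norm (P - R) = c * norm A0"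
        unfolding gT by (simp add: c_def)
      then have "real_conjugation g (T (P - R)) = norm (P - R) *\<^sub>R (A0 /\<^sub>R norm A0)"
        using A0 gT by simp
      then show ?thesis
        by (intro bexI[OF _ linear_isometries_comp[OF real_conjugation_isometry[OF g(1)] T(1)]]) simp
    qed
  next
    have "E a \<bullet> E a \<noteq> E a \<bullet> E b"
      using ab by (simp add: E_def inner_outer inner_axis_axis)
    then have "E a \<noteq> E b" by auto
    moreover have "E a \<in> ?Q" "E b \<in> ?Q"
      by (auto simp: E_def outer_in_proj_space norm_axis_1)
    ultimately show "\<exists>x\<in>?Q. \<exists>y\<in>?Q. x \<noteq> y" by blast
  qed
  then show ?thesis by blast
qed

end


section \<open>Phase changes\<close>

context composition_algebra
begin

lemma outer_axis: "outer (axis a 1) (axis a 1) $ i $ j = (if i = a \<and> j = a then e else 0)"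
  by (auto simp: outer_def axis_def)

lemma unit_phase: "\<exists>u r. u \<bullet> u = 1 \<and> u \<odot> x = r *\<^sub>R e"
proof (cases "x = 0")
  case True
  then show ?thesis
    by (intro exI[of _ e] exI[of _ 0]) (simp add: mul_simps)
next
  case False
  then show ?thesis
    by (intro exI[of _ "cj x /\<^sub>R norm x"] exI[of _ "norm x"])
      (simp add: mul_simps cj_mul_self dot_square_norm power2_eq_square field_simps)
qed

definition phase_conjugation :: "('m \<Rightarrow> 'f) \<Rightarrow> 'f^'m::finite^'m \<Rightarrow> 'f^'m^'m" where
  "phase_conjugation u P = (\<chi> i j. (u i \<odot> P $ i $ j) \<odot> cj (u j))"

text \<open>Conjugation by a diagonal matrix of unit elements preserves products by associativity
  and fixes real diagonal matrices, in particular the coordinate projections. The units are chosen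
  to make one column real, after which \<open>real_column_imp_outer\<close> applies.\<close>

lemma realify_associative:
  fixes P :: "'f^'m::finite^'m"
  assumes assoc: "\<And>x y z. (x \<odot> y) \<odot> z = x \<odot> (y \<odot> z)" and P: "P \<in> proj_space (\<odot>) cj e"
  shows "\<exists>T\<in>linear_isometries (proj_space (\<odot>) cj e). \<exists>p. norm p = 1 \<and> T P = outer p p \<and>
    (\<forall>a. T (outer (axis a 1) (axis a 1)) = outer (axis a 1) (axis a 1))"
proof -
  let ?Q = "proj_space (\<odot>) cj e :: ('f^'m^'m) set"
  have mem: "phase_conjugation u R \<in> ?Q" if u: "\<And>i. u i \<bullet> u i = 1" and R: "R \<in> ?Q" for u R
  proof -
    have "((u i \<odot> R $ i $ k) \<odot> cj (u k)) \<odot> ((u k \<odot> R $ k $ j) \<odot> cj (u j))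
        = u i \<odot> ((R $ i $ k \<odot> R $ k $ j) \<odot> cj (u j))" for i j k
    proof -
      have "((u i \<odot> R $ i $ k) \<odot> cj (u k)) \<odot> ((u k \<odot> R $ k $ j) \<odot> cj (u j))
          = u i \<odot> (R $ i $ k \<odot> (cj (u k) \<odot> (u k \<odot> (R $ k $ j \<odot> cj (u j)))))"
        by (simp only: assoc)
      then show ?thesis
        by (simp only: cj_mul_cancel_left u scaleR_one) (simp only: assoc)
    qed
    then have "(\<Sum>k\<in>UNIV. ((u i \<odot> R $ i $ k) \<odot> cj (u k)) \<odot> ((u k \<odot> R $ k $ j) \<odot> cj (u j)))
        = u i \<odot> ((\<Sum>k\<in>UNIV. R $ i $ k \<odot> R $ k $ j) \<odot> cj (u j))" for i j
      by (simp only: mul_sum_left mul_sum_right)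
    then have "(\<Sum>k\<in>UNIV. ((u i \<odot> R $ i $ k) \<odot> cj (u k)) \<odot> ((u k \<odot> R $ k $ j) \<odot> cj (u j)))
        = (u i \<odot> R $ i $ j) \<odot> cj (u j)" for i j
      by (simp only: proj_idempotent[OF R] assoc)
    note idem = this
    have herm: "(u j \<odot> R $ j $ i) \<odot> cj (u i) = cj ((u i \<odot> R $ i $ j) \<odot> cj (u j))" for i j
      by (subst proj_hermitian[OF R]) (simp add: cj_mul assoc)
    have diag: "(u i \<odot> R $ i $ i) \<odot> cj (u i) = R $ i $ i" for i
    proof -
      obtain x where "R $ i $ i = x *\<^sub>R e" using proj_diagonal[OF R] by blast
      then show ?thesis by (simp add: mul_simps mul_cj_self u)
    qed
    show ?thesis
      unfolding proj_space_def mem_Collect_eq phase_conjugation_def vec_lambda_beta diag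
      using idem herm proj_trace[OF R] by blast
  qed
  have isom: "phase_conjugation u \<in> linear_isometries ?Q" if u: "\<And>i. u i \<bullet> u i = 1" for u
  proof (rule linear_isometriesI[where S = "phase_conjugation (\<lambda>i. cj (u i))"])
    show "linear (phase_conjugation u)"
      by (rule linearI) (simp_all add: phase_conjugation_def vec_eq_iff mul_simps)
    have "norm (u i) = 1" for i
      using u by (simp add: norm_eq_1)
    then show "norm (phase_conjugation u R) = norm R" for R
      by (intro norm_matrix_cong) (simp add: phase_conjugation_def norm_mul)
    show "phase_conjugation u (phase_conjugation (\<lambda>i. cj (u i)) R) = R" for R
      using u by (simp add: phase_conjugation_def vec_eq_iff assoc mul_cj_cancel_left mul_cj_self)
  qed (use u mem in auto)
  obtain k where k: "P $ k $ k \<noteq> 0"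
    using proj_diagonal_nonzero[OF P] by blast
  have "\<forall>i. \<exists>u r. u \<bullet> u = 1 \<and> u \<odot> P $ i $ k = r *\<^sub>R e"
    using unit_phase by blast
  then obtain u0 r where u0: "\<And>i. u0 i \<bullet> u0 i = 1" "\<And>i. u0 i \<odot> P $ i $ k = r i *\<^sub>R e"
    by metis
  \<comment> \<open>With \<open>u k = e\<close>, column \<open>k\<close> is multiplied from the left
    only, each entry by the phase that makes it real; its diagonal entry is already real and
    stays.\<close>
  define u where "u = u0(k := e)"
  have u: "u i \<bullet> u i = 1" for i by (simp add: u_def u0)
  obtain x where x: "P $ k $ k = x *\<^sub>R e"
    using proj_diagonal[OF P] by blast
  have "phase_conjugation u P $ i $ k = (r(k := x)) i *\<^sub>R e" for i
    by (simp add: phase_conjugation_def u_def u0 x)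
  moreover have "phase_conjugation u P $ k $ k \<noteq> 0"
    using k by (simp add: phase_conjugation_def u_def)
  ultimately obtain p where "norm p = 1" "phase_conjugation u P = outer p p"
    using real_column_imp_outer[OF mem[of u P, OF u P], of k "r(k := x)"] by blast
  moreover have "phase_conjugation u (outer (axis a 1) (axis a 1)) = outer (axis a 1) (axis a 1)" for a
    using u by (auto simp: phase_conjugation_def vec_eq_iff outer_axis mul_simps mul_cj_self)
  ultimately show ?thesis
    using isom[of u, OF u] by blast
qed

text \<open>The element \<open>y\<close> lies in a copy of the complex numbers, in which a cube root exists.\<close>

lemma cubic_phase: "\<exists>v r. v \<bullet> v = 1 \<and> v \<odot> ((y \<odot> v) \<odot> v) = r *\<^sub>R e"
proof -
  define m where "m = y - (y \<bullet> e) *\<^sub>R e"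
  show ?thesis
  proof (cases "m = 0")
    case True
    then show ?thesis
      by (intro exI[of _ e] exI[of _ "y \<bullet> e"]) (simp add: m_def)
  next
    case False
    define n where "n = m /\<^sub>R norm m"
    have "m \<bullet> e = 0"
      by (simp add: m_def inner_diff_left)
    then have ne: "n \<bullet> e = 0" and nn: "n \<bullet> n = 1"
      using False by (auto simp: n_def dot_square_norm power2_eq_square)
    \<comment> \<open>\<open>n\<close> is orthogonal to \<open>e\<close>, so its conjugate is
      \<open>- n\<close>: it is an imaginary unit, and \<open>h\<close> below embeds the complex
      numbers.\<close>
    have "n \<odot> n = - e"
      using mul_cj_self[of n] by (simp add: cj_eq ne nn mul_simps minus_equation_iff[of "n \<odot> n"])
    define h where "h w = Re w *\<^sub>R e + Im w *\<^sub>R n" for w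
    have h_mul: "h w \<odot> h z = h (w * z)" for w z
      by (simp add: h_def mul_simps \<open>n \<odot> n = - e\<close> algebra_simps)
    define c where "c = Complex (y \<bullet> e) (norm m)"
    have y: "y = h c"
      using False by (simp add: h_def c_def n_def m_def)
    \<comment> \<open>The cube of \<open>w\<close> is inverse to the phase of \<open>c\<close>, so
      the product of \<open>c\<close> with three factors \<open>w\<close> is the modulus of
      \<open>c\<close>.\<close>
    define w where "w = cis (- Arg c / 3)"
    have "w * ((c * w) * w) = of_real (norm c) * (cis (Arg c) * w ^ 3)"
      using rcis_cmod_Arg[of c] by (simp add: rcis_def power3_eq_cube mult_ac)
    also have "cis (Arg c) * w ^ 3 = 1"
    proof -
      have "w ^ 3 = cis (real 3 * (- Arg c / 3))"
        unfolding w_def by (rule Complex.DeMoivre)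
      then show ?thesis by (simp add: cis_mult)
    qed
    finally have "v \<odot> ((y \<odot> v) \<odot> v) = norm c *\<^sub>R e" if "v = h w" for v
      unfolding that y h_mul by (simp add: h_def)
    moreover have "h w \<bullet> h w = 1"
      using ne nn by (simp add: h_def inner_simps inner_commute w_def flip: power2_eq_square)
    ultimately show ?thesis by blast
  qed
qed

text \<open>For a unit element \<open>u\<close> of an associative algebra this is conjugation by the
  diagonal matrix with entries \<open>u\<close>, \<open>e\<close>, \<open>cj u\<close>. Over the
  octonions the effect is prescribed entry by entry: left, right and two-sided multiplication by
  \<open>u\<close> are the three maps that triality links.\<close>

definition triality_twist :: "'m \<Rightarrow> 'm \<Rightarrow> 'm \<Rightarrow> 'f \<Rightarrow> 'f^'m::finite^'m \<Rightarrow> 'f^'m^'m" where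
  "triality_twist a b c u P = (\<chi> i j.
    if (i, j) = (a, b) then u \<odot> P $ a $ b else if (i, j) = (b, a) then P $ b $ a \<odot> cj u
    else if (i, j) = (b, c) then P $ b $ c \<odot> u else if (i, j) = (c, b) then cj u \<odot> P $ c $ b
    else if (i, j) = (a, c) then (u \<odot> P $ a $ c) \<odot> u
    else if (i, j) = (c, a) then (cj u \<odot> P $ c $ a) \<odot> cj u else P $ i $ j)"

context
  fixes a b c :: "'m::finite"
  assumes abc: "UNIV = {a, b, c}" "a \<noteq> b" "b \<noteq> c" "a \<noteq> c"
begin

lemma sum_three: "(\<Sum>i\<in>UNIV. f i) = f a + (f b + (f c :: 'v::comm_monoid_add))"
  unfolding abc(1) using abc(2-4) by simp

lemma all_three: "(\<forall>i. S i) \<longleftrightarrow> S a \<and> S b \<and> S c"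
  using abc(1) by (metis UNIV_I empty_iff insert_iff)

lemma twist_entries:
  "triality_twist a b c u P $ a $ b = u \<odot> P $ a $ b"
  "triality_twist a b c u P $ b $ a = P $ b $ a \<odot> cj u"
  "triality_twist a b c u P $ b $ c = P $ b $ c \<odot> u"
  "triality_twist a b c u P $ c $ b = cj u \<odot> P $ c $ b"
  "triality_twist a b c u P $ a $ c = (u \<odot> P $ a $ c) \<odot> u"
  "triality_twist a b c u P $ c $ a = (cj u \<odot> P $ c $ a) \<odot> cj u"
  "triality_twist a b c u P $ i $ i = P $ i $ i"
  using abc(2-4) by (auto simp: triality_twist_def)

text \<open>Each off-diagonal equation of idempotence contains one product of two other off-diagonal
  entries, and each calls for its own Moufang identity: left for \<open>(a, b)\<close>, right for
  \<open>(b, c)\<close>, middle for \<open>(a, c)\<close>. The opposite entries follow by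
  conjugation, and the diagonal equations involve only norms.\<close>

lemma twist_in_proj_space:
  assumes u: "u \<bullet> u = 1" and P: "P \<in> proj_space (\<odot>) cj e"
  shows "triality_twist a b c u P \<in> proj_space (\<odot>) cj e"
proof -
  let ?T = "triality_twist a b c u P"
  define x y z where "x = P $ a $ b" and "y = P $ b $ c" and "z = P $ a $ c"
  have low: "P $ b $ a = cj x" "P $ c $ b = cj y" "P $ c $ a = cj z"
    by (auto simp: x_def y_def z_def intro: proj_hermitian[OF P])
  obtain \<alpha> \<beta> \<gamma> where diag: "P $ a $ a = \<alpha> *\<^sub>R e" "P $ b $ b = \<beta> *\<^sub>R e" "P $ c $ c = \<gamma> *\<^sub>R e"
    using proj_diagonal[OF P] by blast
  note entries = x_def[symmetric] y_def[symmetric] z_def[symmetric] low diag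
  have ab: "\<alpha> *\<^sub>R x + (\<beta> *\<^sub>R x + z \<odot> cj y) = x" and bc: "cj x \<odot> z + (\<beta> *\<^sub>R y + \<gamma> *\<^sub>R y) = y"
    and ac: "\<alpha> *\<^sub>R z + (x \<odot> y + \<gamma> *\<^sub>R z) = z"
    using proj_idempotent[OF P, of a b] proj_idempotent[OF P, of b c] proj_idempotent[OF P, of a c]
    by (simp_all add: sum_three entries mul_simps)
  have sq: "(\<alpha> * \<alpha>) *\<^sub>R e + ((x \<bullet> x) *\<^sub>R e + (z \<bullet> z) *\<^sub>R e) = \<alpha> *\<^sub>R e"
    "(x \<bullet> x) *\<^sub>R e + ((\<beta> * \<beta>) *\<^sub>R e + (y \<bullet> y) *\<^sub>R e) = \<beta> *\<^sub>R e"
    "(z \<bullet> z) *\<^sub>R e + ((y \<bullet> y) *\<^sub>R e + (\<gamma> * \<gamma>) *\<^sub>R e) = \<gamma> *\<^sub>R e"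
    using proj_idempotent[OF P, of a a] proj_idempotent[OF P, of b b] proj_idempotent[OF P, of c c]
    by (simp_all add: sum_three entries mul_simps mul_cj_self cj_mul_self)
  define x' y' z' where "x' = u \<odot> x" and "y' = y \<odot> u" and "z' = (u \<odot> z) \<odot> u"
  have cj': "cj x' = cj x \<odot> cj u" "cj y' = cj u \<odot> cj y" "cj z' = (cj u \<odot> cj z) \<odot> cj u"
    by (simp_all add: x'_def y'_def z'_def cj_mul sandwich_assoc)
  have T: "?T $ a $ b = x'" "?T $ b $ a = cj x'" "?T $ b $ c = y'" "?T $ c $ b = cj y'"
    "?T $ a $ c = z'" "?T $ c $ a = cj z'"
    "?T $ a $ a = \<alpha> *\<^sub>R e" "?T $ b $ b = \<beta> *\<^sub>R e" "?T $ c $ c = \<gamma> *\<^sub>R e"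
    by (simp_all only: twist_entries entries cj') (simp_all only: x'_def y'_def z'_def)
  have norms: "x' \<bullet> x' = x \<bullet> x" "y' \<bullet> y' = y \<bullet> y" "z' \<bullet> z' = z \<bullet> z"
    by (simp_all add: x'_def y'_def z'_def inner_mul_self u)
  have ab': "\<alpha> *\<^sub>R x' + (\<beta> *\<^sub>R x' + z' \<odot> cj y') = x'"
    using arg_cong[OF ab, of "\<lambda>s. u \<odot> s"]
    by (simp add: cj'(2)) (simp add: x'_def z'_def moufang_left[OF u] mul_simps)
  have bc': "cj x' \<odot> z' + (\<beta> *\<^sub>R y' + \<gamma> *\<^sub>R y') = y'"
    using arg_cong[OF bc, of "\<lambda>s. s \<odot> u"]
    by (simp add: cj'(1)) (simp add: y'_def z'_def moufang_right[OF u] mul_simps)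
  have ac': "\<alpha> *\<^sub>R z' + (x' \<odot> y' + \<gamma> *\<^sub>R z') = z'"
    using arg_cong[OF ac, of "\<lambda>s. (u \<odot> s) \<odot> u"]
    by (simp add: x'_def y'_def z'_def moufang_middle mul_simps)
  have ba': "\<alpha> *\<^sub>R cj x' + (\<beta> *\<^sub>R cj x' + y' \<odot> cj z') = cj x'"
    using arg_cong[OF ab', of cj] by (simp add: cj_mul)
  have cb': "cj z' \<odot> x' + (\<beta> *\<^sub>R cj y' + \<gamma> *\<^sub>R cj y') = cj y'"
    using arg_cong[OF bc', of cj] by (simp add: cj_mul)
  have ca': "\<alpha> *\<^sub>R cj z' + (cj y' \<odot> cj x' + \<gamma> *\<^sub>R cj z') = cj z'"
    using arg_cong[OF ac', of cj] by (simp add: cj_mul)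
  have trace: "\<alpha> *\<^sub>R e + (\<beta> *\<^sub>R e + \<gamma> *\<^sub>R e) = e"
    using proj_trace[OF P] by (simp add: sum_three diag)
  show ?thesis
    unfolding proj_space_def mem_Collect_eq all_three sum_three T
    using ab' bc' ac' ba' cb' ca' trace sq
    by (simp add: mul_simps mul_cj_self cj_mul_self norms cj_mul add_ac)
qed

lemma twist_isometry:
  assumes u: "u \<bullet> u = 1"
  shows "triality_twist a b c u \<in> linear_isometries (proj_space (\<odot>) cj e)"
proof (rule linear_isometriesI[where S = "triality_twist a b c (cj u)"])
  show "linear (triality_twist a b c u)"
    by (rule linearI; unfold vec_eq_iff all_three) (simp_all add: twist_entries mul_simps)
  have "norm u = 1"
    using u by (simp add: norm_eq_1)
  then have "\<forall>i j. norm (triality_twist a b c u P $ i $ j) = norm (P $ i $ j)" for P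
    unfolding all_three by (simp add: twist_entries norm_mul)
  then show "norm (triality_twist a b c u P) = norm P" for P
    by (intro norm_matrix_cong) blast
  show "triality_twist a b c u (triality_twist a b c (cj u) P) = P" for P
  proof -
    have "(u \<odot> ((cj u \<odot> z) \<odot> cj u)) \<odot> u = z" "(cj u \<odot> ((u \<odot> z) \<odot> u)) \<odot> cj u = z" for z
      by (simp_all add: sandwich_assoc[of "cj u" z] sandwich_assoc[of u z] mul_cj_cancel_left
          cj_mul_cancel_left mul_cj_cancel_right cj_mul_cancel_right u)
    then show ?thesis
      unfolding vec_eq_iff all_three
      by (simp add: twist_entries mul_cj_cancel_left cj_mul_cancel_left mul_cj_cancel_right
          cj_mul_cancel_right u)
  qed
qed (use u twist_in_proj_space in auto)

lemma twist_axis: "triality_twist a b c u (outer (axis i 1) (axis i 1)) = outer (axis i 1) (axis i 1)"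
proof -
  have "outer (axis i 1) (axis i 1) $ j $ k = 0" if "j \<noteq> k" for j k
    using that by (auto simp: outer_axis)
  then show ?thesis
    unfolding vec_eq_iff all_three using abc(2-4) by (simp add: twist_entries mul_simps)
qed

end

text \<open>The first twist makes the entry \<open>(a, b)\<close> real; the two others leave it unchanged and multiply
  the entry \<open>(a, c)\<close> by three phases.\<close>

lemma realify_from_diagonal:
  fixes P :: "'f^'m::finite^'m"
  assumes abc: "UNIV = {a, b, c}" "a \<noteq> b" "b \<noteq> c" "a \<noteq> c"
    and P: "P \<in> proj_space (\<odot>) cj e" and a: "P $ a $ a \<noteq> 0"
  shows "\<exists>T\<in>linear_isometries (proj_space (\<odot>) cj e). \<exists>p. norm p = 1 \<and> T P = outer p p \<and>
    (\<forall>a. T (outer (axis a 1) (axis a 1)) = outer (axis a 1) (axis a 1))"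
proof -
  let ?Q = "proj_space (\<odot>) cj e :: ('f^'m^'m) set"
  have bac: "UNIV = {b, a, c}" "b \<noteq> a" "a \<noteq> c" "b \<noteq> c"
    using abc by auto
  obtain u r where u: "u \<bullet> u = 1" "u \<odot> P $ a $ b = r *\<^sub>R e"
    using unit_phase by blast
  obtain v s where v: "v \<bullet> v = 1" "v \<odot> ((((u \<odot> P $ a $ c) \<odot> u) \<odot> v) \<odot> v) = s *\<^sub>R e"
    using cubic_phase by blast
  \<comment> \<open>In the middle twist \<open>a\<close> and \<open>b\<close> are exchanged: it
    multiplies \<open>(a, b)\<close> from the right by \<open>cj v\<close> and \<open>(a, c)\<close>
    from the right by \<open>v\<close>. The last twist multiplies \<open>(a, b)\<close> from the
    left by \<open>v\<close>, which restores its real value, and sandwiches \<open>(a, c)\<close>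
    between two factors \<open>v\<close>. The result is the product that \<open>v\<close> was chosen
    to make real.\<close>
  define T where "T = triality_twist a b c v \<circ> (triality_twist b a c v \<circ> triality_twist a b c u)"
  have T: "T \<in> linear_isometries ?Q"
    unfolding T_def
    by (intro linear_isometries_comp twist_isometry[OF abc] twist_isometry[OF bac] u v)
  then have TP: "T P \<in> ?Q"
    using P by (rule linear_isometries_mem)
  obtain \<alpha> where \<alpha>: "P $ a $ a = \<alpha> *\<^sub>R e"
    using proj_diagonal[OF P] by blast
  have "T P $ a $ a = \<alpha> *\<^sub>R e"
    by (simp add: T_def twist_entries[OF abc] twist_entries[OF bac] \<alpha>)
  moreover have "T P $ b $ a = r *\<^sub>R e"
  proof -
    have "T P $ a $ b = r *\<^sub>R e"
      by (simp add: T_def twist_entries[OF abc] twist_entries[OF bac] u mul_simps mul_cj_self v)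
    then show ?thesis using proj_hermitian[OF TP, of b a] by simp
  qed
  moreover have "T P $ c $ a = s *\<^sub>R e"
  proof -
    have "T P $ a $ c = s *\<^sub>R e"
      by (simp add: T_def twist_entries[OF abc] twist_entries[OF bac] sandwich_assoc[of v] v)
    then show ?thesis using proj_hermitian[OF TP, of c a] by simp
  qed
  ultimately have "\<forall>i. \<exists>x. T P $ i $ a = x *\<^sub>R e"
    unfolding all_three[OF abc] by blast
  then obtain x where x: "\<And>i. T P $ i $ a = x i *\<^sub>R e"
    by metis
  have "T P $ a $ a \<noteq> 0"
    using a \<alpha> \<open>T P $ a $ a = \<alpha> *\<^sub>R e\<close> by simp
  then obtain p where "norm p = 1" "T P = outer p p"
    using real_column_imp_outer[OF TP _ x] by blast
  moreover have "T (outer (axis i 1) (axis i 1)) = outer (axis i 1) (axis i 1)" for i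
    by (simp add: T_def twist_axis[OF abc] twist_axis[OF bac])
  ultimately show ?thesis
    using T by blast
qed

text \<open>The trace is nonzero, so some diagonal entry is; its index takes the role of
  \<open>a\<close> in \<open>realify_from_diagonal\<close>.\<close>

lemma realify_three:
  fixes P :: "'f^3^3"
  assumes P: "P \<in> proj_space (\<odot>) cj e"
  shows "\<exists>T\<in>linear_isometries (proj_space (\<odot>) cj e). \<exists>p. norm p = 1 \<and> T P = outer p p \<and>
    (\<forall>a. T (outer (axis a 1) (axis a 1)) = outer (axis a 1) (axis a 1))"
proof -
  obtain k where k: "P $ k $ k \<noteq> 0"
    using proj_diagonal_nonzero[OF P] by blast
  have distinct_3: "(1::3) \<noteq> 2" "(1::3) \<noteq> 3" "(2::3) \<noteq> 3"
    by simp_all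
  have "UNIV = {1, 2, 3 :: 3}" "UNIV = {2, 1, 3 :: 3}" "UNIV = {3, 1, 2 :: 3}"
    unfolding UNIV_3 by blast+
  then have "\<exists>b c. UNIV = {k, b, c} \<and> k \<noteq> b \<and> b \<noteq> c \<and> k \<noteq> c"
    using exhaust_3[of k] by (metis distinct_3)
  then show ?thesis
    using realify_from_diagonal[OF _ _ _ _ P k] by blast
qed

end


section \<open>Stolarsky's principle for the two-point homogeneous spaces\<close>

lemma (in spherical_embedding) stolarsky_invariance_principle:
  assumes "invariant_measure Q \<theta> \<mu>"
  shows "(\<forall>D\<in>point_sets \<mu> N. gamma_const \<theta> \<mu> * discrepancy \<theta> \<mu> sin D + distance_sum (chordal \<theta>) D
      = mean_distance \<mu> (chordal \<theta>) * (real N)\<^sup>2) \<and>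
    gamma_const \<theta> \<mu> * min_discrepancy \<theta> \<mu> sin N + max_distance_sum \<mu> (chordal \<theta>) N
      = mean_distance \<mu> (chordal \<theta>) * (real N)\<^sup>2"
proof -
  interpret invariant_embedding Q \<theta> \<alpha> A \<mu>
    by unfold_locales fact
  show ?thesis
    using stolarsky_invariance stolarsky_invariance_extremal by blast
qed

lemma orthogonal_transformation_sphere:
  assumes "orthogonal_transformation T" shows "T \<in> linear_isometries (sphere 0 1)"
proof -
  note norm_T = orthogonal_transformation_norm[OF assms]
  have "x \<in> T ` sphere 0 1" if "x \<in> sphere 0 1" for x
  proof -
    obtain y where "x = T y"
      using orthogonal_transformation_surj[OF assms] by (rule surjE)
    with that show ?thesis by (simp add: norm_T)
  qed
  then show ?thesis
    using assms by (auto simp: linear_isometries_def norm_T)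
qed

text \<open>A single reflection carries a difference to any vector of the same length, so any unit
  vector can serve as the fixed direction.\<close>

lemma sphere_spherical_embedding:
  assumes "CARD('k::finite) \<ge> 2"
  shows "spherical_embedding (sphere 0 1 :: (real^'k) set) sphere_theta 1 (axis k 1)"
proof
  fix x y :: "real^'k" assume "x \<in> sphere 0 1" "y \<in> sphere 0 1"
  then have xy: "norm x = 1" "norm y = 1" by auto
  then have "\<bar>x \<bullet> y\<bar> \<le> 1"
    using Cauchy_Schwarz_ineq2[of x y] by simp
  then show "0 \<le> sphere_theta x y \<and> sphere_theta x y \<le> pi"
    "cos (sphere_theta x y) = 1 - 1 * (1 - x \<bullet> y)"
    using arccos_bounded[of "x \<bullet> y"] by (auto simp: sphere_theta_def abs_le_iff)
  show "\<exists>T\<in>linear_isometries (sphere 0 1). T x = y"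
    using exists_reflection[of x y] xy orthogonal_transformation_sphere by (metis (no_types, lifting))
  have "norm (x - y) = norm (norm (x - y) *\<^sub>R (axis k 1 :: real^'k))"
    by (simp add: norm_axis_1)
  from exists_reflection[OF this]
  obtain T where "orthogonal_transformation T" "T (x - y) = norm (x - y) *\<^sub>R (axis k 1 :: real^'k)"
    by blast
  then show "\<exists>T\<in>linear_isometries (sphere 0 1). T (x - y) = norm (x - y) *\<^sub>R axis k 1"
    using orthogonal_transformation_sphere by blast
next
  have "(axis k 1 :: real^'k) \<noteq> - axis k 1"
    by (auto simp: vec_eq_iff axis_def intro!: exI[of _ k])
  then show "\<exists>x\<in>sphere 0 1. \<exists>y\<in>sphere (0 :: real^'k) 1. x \<noteq> y"
    by (intro bexI[of _ "axis k 1"] bexI[of _ "- axis k 1"]) (auto simp: norm_axis_1)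
qed auto

text \<open>This covers the real, complex and quaternionic spaces of projective dimension n, where
  \<open>CARD('m)\<close> is n + 1.\<close>

lemma (in composition_algebra) proj_space_stolarsky_associative:
  fixes \<mu> :: "('f^'m::finite^'m) measure"
  assumes "\<And>x y z. (x \<odot> y) \<odot> z = x \<odot> (y \<odot> z)" "CARD('m) \<ge> 3"
    "invariant_measure (proj_space (\<odot>) cj e) proj_theta \<mu>"
  shows "(\<forall>D\<in>point_sets \<mu> N.
        gamma_const proj_theta \<mu> * discrepancy proj_theta \<mu> sin D + distance_sum (chordal proj_theta) D
          = mean_distance \<mu> (chordal proj_theta) * (real N)\<^sup>2) \<and>
      gamma_const proj_theta \<mu> * min_discrepancy proj_theta \<mu> sin N + max_distance_sum \<mu> (chordal proj_theta) N
        = mean_distance \<mu> (chordal proj_theta) * (real N)\<^sup>2"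
proof -
  obtain A where "spherical_embedding (proj_space (\<odot>) cj e :: ('f^'m^'m) set) proj_theta 2 A"
  proof -
    have "\<exists>A. spherical_embedding (proj_space (\<odot>) cj e :: ('f^'m^'m) set) proj_theta 2 A"
      by (rule proj_spherical_embedding, erule realify_associative[OF assms(1)])
        (use assms(2) in simp)
    with that show ?thesis by blast
  qed
  then show ?thesis
    using assms(3) by (rule spherical_embedding.stolarsky_invariance_principle)
qed

lemma (in composition_algebra) proj_plane_stolarsky:
  fixes \<mu> :: "('f^3^3) measure"
  assumes "invariant_measure (proj_space (\<odot>) cj e) proj_theta \<mu>"
  shows "(\<forall>D\<in>point_sets \<mu> N.
        gamma_const proj_theta \<mu> * discrepancy proj_theta \<mu> sin D + distance_sum (chordal proj_theta) D
          = mean_distance \<mu> (chordal proj_theta) * (real N)\<^sup>2) \<and>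
      gamma_const proj_theta \<mu> * min_discrepancy proj_theta \<mu> sin N + max_distance_sum \<mu> (chordal proj_theta) N
        = mean_distance \<mu> (chordal proj_theta) * (real N)\<^sup>2"
proof -
  obtain A where "spherical_embedding (proj_space (\<odot>) cj e :: ('f^3^3) set) proj_theta 2 A"
  proof -
    have "\<exists>A. spherical_embedding (proj_space (\<odot>) cj e :: ('f^3^3) set) proj_theta 2 A"
      by (rule proj_spherical_embedding, erule realify_three) simp
    with that show ?thesis by blast
  qed
  then show ?thesis
    using assms by (rule spherical_embedding.stolarsky_invariance_principle)
qed

theorem corollary2p1:
  shows "
    (CARD('k::finite) \<ge> 2 \<longrightarrow> (\<forall>\<mu> :: (real^'k) measure. invariant_measure (sphere 0 1) sphere_theta \<mu> \<longrightarrow>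
       (\<forall>N. (\<forall>D\<in>point_sets \<mu> N.
          gamma_const sphere_theta \<mu> * discrepancy sphere_theta \<mu> sin D + distance_sum (chordal sphere_theta) D
            = mean_distance \<mu> (chordal sphere_theta) * (real N)\<^sup>2) \<and>
          gamma_const sphere_theta \<mu> * min_discrepancy sphere_theta \<mu> sin N + max_distance_sum \<mu> (chordal sphere_theta) N
            = mean_distance \<mu> (chordal sphere_theta) * (real N)\<^sup>2))) \<and>
    (CARD('m::finite) \<ge> 3 \<longrightarrow> (\<forall>\<mu> :: (real^'m^'m) measure. invariant_measure real_proj_space proj_theta \<mu> \<longrightarrow>
       (\<forall>N. (\<forall>D\<in>point_sets \<mu> N.
          gamma_const proj_theta \<mu> * discrepancy proj_theta \<mu> sin D + distance_sum (chordal proj_theta) D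
            = mean_distance \<mu> (chordal proj_theta) * (real N)\<^sup>2) \<and>
          gamma_const proj_theta \<mu> * min_discrepancy proj_theta \<mu> sin N + max_distance_sum \<mu> (chordal proj_theta) N
            = mean_distance \<mu> (chordal proj_theta) * (real N)\<^sup>2))) \<and>
    (CARD('m::finite) \<ge> 3 \<longrightarrow> (\<forall>\<mu> :: (complex^'m^'m) measure. invariant_measure complex_proj_space proj_theta \<mu> \<longrightarrow>
       (\<forall>N. (\<forall>D\<in>point_sets \<mu> N.
          gamma_const proj_theta \<mu> * discrepancy proj_theta \<mu> sin D + distance_sum (chordal proj_theta) D
            = mean_distance \<mu> (chordal proj_theta) * (real N)\<^sup>2) \<and>
          gamma_const proj_theta \<mu> * min_discrepancy proj_theta \<mu> sin N + max_distance_sum \<mu> (chordal proj_theta) N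
            = mean_distance \<mu> (chordal proj_theta) * (real N)\<^sup>2))) \<and>
    (CARD('m::finite) \<ge> 3 \<longrightarrow> (\<forall>\<mu> :: (quat^'m^'m) measure. invariant_measure quat_proj_space proj_theta \<mu> \<longrightarrow>
       (\<forall>N. (\<forall>D\<in>point_sets \<mu> N.
          gamma_const proj_theta \<mu> * discrepancy proj_theta \<mu> sin D + distance_sum (chordal proj_theta) D
            = mean_distance \<mu> (chordal proj_theta) * (real N)\<^sup>2) \<and>
          gamma_const proj_theta \<mu> * min_discrepancy proj_theta \<mu> sin N + max_distance_sum \<mu> (chordal proj_theta) N
            = mean_distance \<mu> (chordal proj_theta) * (real N)\<^sup>2))) \<and>
    ((\<forall>\<mu> :: (oct^3^3) measure. invariant_measure oct_proj_plane proj_theta \<mu> \<longrightarrow>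
       (\<forall>N. (\<forall>D\<in>point_sets \<mu> N.
          gamma_const proj_theta \<mu> * discrepancy proj_theta \<mu> sin D + distance_sum (chordal proj_theta) D
            = mean_distance \<mu> (chordal proj_theta) * (real N)\<^sup>2) \<and>
          gamma_const proj_theta \<mu> * min_discrepancy proj_theta \<mu> sin N + max_distance_sum \<mu> (chordal proj_theta) N
            = mean_distance \<mu> (chordal proj_theta) * (real N)\<^sup>2)))"
proof (intro conjI[of "_ \<longrightarrow> _"] impI allI, goal_cases)
  case (1 \<mu> N)
  then show ?case
    by (intro spherical_embedding.stolarsky_invariance_principle[OF sphere_spherical_embedding])
next
  case (2 \<mu> N)
  then show ?case
    by (intro composition_algebra.proj_space_stolarsky_associative[OF composition_algebra_real]) simp_all
next
  case (3 \<mu> N)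
  then show ?case
    by (intro composition_algebra.proj_space_stolarsky_associative[OF composition_algebra_complex]) simp_all
next
  case (4 \<mu> N)
  then show ?case
    by (intro composition_algebra.proj_space_stolarsky_associative[OF composition_algebra_quat])
      (simp_all add: quat_mult_assoc)
next
  case (5 \<mu> N)
  then show ?case
    by (rule composition_algebra.proj_plane_stolarsky[OF composition_algebra_oct])
qed

end
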